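(* Let $n\in\mathbb{N}$ ($n\ge1$) and let $h$ be the heat kernel associated with $\mathcal{L}$ on $\mathbb{H}^n$. Then for every $i\in\{1,\dots,2n\}$ $$\int_{\mathbb{H}^n}x_i^6\,h(1,x)\,dx=5!\qquad\text{and}\qquad\int_{\mathbb{H}^n}x_i^2x_{2n+1}^2\,h(1,x)\,dx=\frac23\big(5+3(n-1)\big).$$
   Context: $\mathbb{H}^n=\mathbb{R}^{2n+1}$ is the Heisenberg group with product $(x_1,\dots,x_{2n+1})(y_1,\dots,y_{2n+1})=\big(x_1+y_1,\dots,x_{2n}+y_{2n},\,x_{2n+1}+y_{2n+1}+\frac12\sum_{i=1}^n(x_iy_{i+n}-x_{i+n}y_i)\big)$. Left-invariant fields: $X_j=\partial_{x_j}-\frac12x_{j+n}\partial_{x_{2n+1}}$, $Y_j=\partial_{x_{n+j}}+\frac12x_j\partial_{x_{2n+1}}$, $1\le j\le n$; $\mathcal{L}=-\sum_{j=1}^n(X_j^2+Y_j^2)$. The heat kernel $h(t,x)$ is the fundamental solution of $\partial_t+\mathcal{L}$ on $\mathbb{R}\times\mathbb{H}^n$ with $h=0$ for $t\le0$; it is non-negative and $\int_{\mathbb{H}^n}h(t,x)dx=1$ for $t>0$. $dx$ is Lebesgue measure. *)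

theory Defs
  imports "HOL-Analysis.Analysis"
begin

section \<open>The Heisenberg group\<close>

text \<open>
  With \<open>n = CARD('n)\<close>, a point of $\mathbb{H}^n = \mathbb{R}^{2n+1}$ is a pair \<open>x\<close>: the
  first 2n coordinates are \<open>fst x $ i\<close> with \<open>i :: 'n + 'n\<close>, where \<open>Inl j\<close> stands for the index
  j and \<open>Inr j\<close> for the index n + j, and the last coordinate is \<open>snd x\<close>.
\<close>

type_synonym 'n heis = "(real ^ ('n + 'n)) \<times> real"

definition heis_mult :: "'n::finite heis \<Rightarrow> 'n heis \<Rightarrow> 'n heis" where
  "heis_mult x y =
     (fst x + fst y,
      snd x + snd y + 1/2 * (\<Sum>i\<in>UNIV. fst x $ Inl i * fst y $ Inr i - fst x $ Inr i * fst y $ Inl i))"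

definition ddir :: "'a::real_normed_vector \<Rightarrow> ('a \<Rightarrow> real) \<Rightarrow> 'a \<Rightarrow> real" where
  "ddir v f x = frechet_derivative f (at x) v"

definition pd :: "'n + 'n \<Rightarrow> ('n::finite heis \<Rightarrow> real) \<Rightarrow> 'n heis \<Rightarrow> real" where
  "pd i = ddir (axis i 1, 0)"

definition pd_last :: "('n::finite heis \<Rightarrow> real) \<Rightarrow> 'n heis \<Rightarrow> real" where
  "pd_last = ddir (0, 1)"

definition X_field :: "'n \<Rightarrow> ('n::finite heis \<Rightarrow> real) \<Rightarrow> 'n heis \<Rightarrow> real" where
  "X_field j f x = pd (Inl j) f x - 1/2 * fst x $ Inr j * pd_last f x"

definition Y_field :: "'n \<Rightarrow> ('n::finite heis \<Rightarrow> real) \<Rightarrow> 'n heis \<Rightarrow> real" where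
  "Y_field j f x = pd (Inr j) f x + 1/2 * fst x $ Inl j * pd_last f x"

definition sublaplacian :: "('n::finite heis \<Rightarrow> real) \<Rightarrow> 'n heis \<Rightarrow> real" where
  "sublaplacian f x =
     - (\<Sum>j\<in>UNIV. X_field j (X_field j f) x + Y_field j (Y_field j f) x)"

text \<open>
  \<open>X_field j\<close> and \<open>Y_field j\<close> are the left-invariant fields: they differentiate along right
  translation by the one-parameter subgroups generated by the coordinate directions.
\<close>

lemma heis_mult_Inl:
  "heis_mult x (s *\<^sub>R (axis (Inl j) 1, 0)) = x + s *\<^sub>R (axis (Inl j) 1, - 1/2 * fst x $ Inr j)"
  by (cases x) (simp add: heis_mult_def axis_def if_distrib[where f="\<lambda>z. _ * z"] sum_negf cong: if_cong)

lemma heis_mult_Inr: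
  "heis_mult x (s *\<^sub>R (axis (Inr j) 1, 0)) = x + s *\<^sub>R (axis (Inr j) 1, 1/2 * fst x $ Inl j)"
  by (cases x) (simp add: heis_mult_def axis_def if_distrib[where f="\<lambda>z. _ * z"] cong: if_cong)

lemma X_field_eq:
  assumes "f differentiable (at x)"
  shows "X_field j f x = frechet_derivative f (at x) (axis (Inl j) 1, - 1/2 * fst x $ Inr j)"
proof -
  interpret linear "frechet_derivative f (at x)"
    using assms by (rule linear_frechet_derivative)
  have eq: "(axis (Inl j) 1, - 1/2 * fst x $ Inr j) =
        (axis (Inl j) 1, 0) - (1/2 * fst x $ Inr j) *\<^sub>R (0, 1)"
    by simp
  show ?thesis
    by (simp only: eq X_field_def pd_def pd_last_def ddir_def diff scale real_scaleR_def)
qed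

lemma Y_field_eq:
  assumes "f differentiable (at x)"
  shows "Y_field j f x = frechet_derivative f (at x) (axis (Inr j) 1, 1/2 * fst x $ Inl j)"
proof -
  interpret linear "frechet_derivative f (at x)"
    using assms by (rule linear_frechet_derivative)
  have eq: "(axis (Inr j) 1, 1/2 * fst x $ Inl j) =
        (axis (Inr j) 1, 0) + (1/2 * fst x $ Inl j) *\<^sub>R (0, 1)"
    by simp
  show ?thesis
    by (simp only: eq Y_field_def pd_def pd_last_def ddir_def add scale real_scaleR_def)
qed


section \<open>Test functions\<close>

primrec C_k :: "nat \<Rightarrow> ('a::real_normed_vector \<Rightarrow> real) \<Rightarrow> bool" where
  "C_k 0 f \<longleftrightarrow> continuous_on UNIV f"
| "C_k (Suc k) f \<longleftrightarrow> (\<forall>x. f differentiable (at x)) \<and> (\<forall>v. C_k k (ddir v f))"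

definition test_function :: "('a::real_normed_vector \<Rightarrow> real) \<Rightarrow> bool" where
  "test_function \<phi> \<longleftrightarrow> (\<forall>k. C_k k \<phi>) \<and> compact (closure {z. \<phi> z \<noteq> 0})"


section \<open>The heat kernel\<close>

text \<open>
  $(\partial_t + \mathcal{L}) h = \delta_0$ as distributions on $\mathbb{R} \times \mathbb{H}^n$.
  The coefficients of $X_j$ and $Y_j$ do not depend on the variables being differentiated, so
  both fields are formally skew-adjoint, $\mathcal{L}$ is formally self-adjoint, and the
  transposed operator is $-\partial_t + \mathcal{L}$. The identity of the group is \<open>0\<close>.
\<close>

definition fundamental_solution :: "(real \<Rightarrow> 'n::finite heis \<Rightarrow> real) \<Rightarrow> bool" where
  "fundamental_solution h \<longleftrightarrow>
     (\<forall>\<phi> :: real \<times> 'n heis \<Rightarrow> real. test_function \<phi> \<longrightarrow>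
        (LINT (t, x)|lborel. h t x * (- deriv (\<lambda>s. \<phi> (s, x)) t + sublaplacian (\<lambda>y. \<phi> (t, y)) x))
          = \<phi> (0, 0))"

text \<open>
  A distributional equation determines \<open>h\<close> only almost everywhere. By hypoellipticity the
  heat kernel is smooth for positive times; continuity there selects this representative and
  gives meaning to \<open>h 1\<close>. Without non-negativity and unit mass the fundamental solution
  vanishing for \<open>t \<le> 0\<close> is not unique: nonzero Tychonoff-type solutions of the homogeneous
  equation that vanish for \<open>t \<le> 0\<close> could be added.
  Local integrability of \<open>h\<close> on $\mathbb{R} \times \mathbb{H}^n$ follows from these conditions.
\<close>

definition heat_kernel :: "(real \<Rightarrow> 'n::finite heis \<Rightarrow> real) \<Rightarrow> bool" where
  "heat_kernel h \<longleftrightarrow>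
     fundamental_solution h \<and>
     (\<forall>t\<le>0. \<forall>x. h t x = 0) \<and>
     continuous_on ({0<..} \<times> UNIV) (\<lambda>(t, x). h t x) \<and>
     (\<forall>t x. h t x \<ge> 0) \<and>
     (\<forall>t>0. (LINT x|lborel. h t x) = 1)"

end

theory Submission
  imports Defs "HOL-Computational_Algebra.Polynomial"
begin

text \<open>
  Write $A = -\mathcal{L}$ and $P_tf = \int f\,h(t,\cdot)\,dx$. The heat equation gives
  $\frac{d}{dt}P_tf = P_t(Af)$ with $P_0f = f(0)$. On polynomials A lowers the degree by two when the
  last coordinate z counts twice, so the moments come out by integrating finitely many times. With
  i' the coordinate conjugate to i, and with a sign depending on i,

    $Ax_i^2 = 2$, \quad $Ax_i^4 = 12x_i^2$, \quad $Ax_i^6 = 30x_i^4$,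

    $A(x_i^2x_k^2) = 2x_i^2 + 2x_k^2$ for $k \neq i$, \quad $Az^2 = \frac12\sum_k x_k^2$,

    $A(z x_ix_{i'}) = \pm(x_{i'}^2 - x_i^2)$, \quad
    $A(z^2x_i^2) = 2z^2 + \frac12\sum_k x_k^2x_i^2 \pm 4z x_ix_{i'}$.

  Hence $P_tx_i^2 = 2t$, $P_tx_i^4 = 12t^2$, $P_tx_i^6 = 120t^3$, $P_t(x_i^2x_k^2) = 4t^2$,
  $P_tz^2 = nt^2$, $P_t(zx_ix_{i'}) = 0$ and finally
  $P_t(z^2x_i^2) = \int_0^t\big(2n + \frac12(12 + 4(2n-1))\big)s^2\,ds = \frac{6n+4}3t^3$.

  The analytic content is the evolution equation for unbounded f, because the kernel is given only
  through a distributional equation, positivity and unit mass. For test functions of space it is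
  obtained from test functions of space-time that are products with a sharpening cutoff in time
  (\<open>hmean_evolution_test\<close>). For polynomials one needs finite moments. Let
  $r = (1 + |x|^4 + z^2)^{1/2}$, a smooth function of weight 2. Cutting off at $r \le R$ costs nothing:
  the cutoff functions have weight 0 uniformly in R (\<open>weighted_spatial_cutoff\<close>), so A applied to the
  truncation of $r^{j+1}$ is bounded by a multiple of $r^j$ that does not depend on R. Starting from
  the unit mass, induction on j bounds all moments of r (\<open>moment_bounded_Suc\<close>), and dominated
  convergence then extends the evolution equation to every function of polynomial weight
  (\<open>hmean_evolution\<close>).
\<close>

section \<open>Smooth functions\<close>

lemma ddir_eq:
  assumes "(f has_derivative D) (at x)"
  shows "ddir v f x = D v"
  using frechet_derivative_at[OF assms] by (simp add: ddir_def)

lemma C_k_SucD: "C_k (Suc k) f \<Longrightarrow> C_k k f"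
proof (induction k arbitrary: f)
  case 0
  then show ?case
    by (auto intro!: differentiable_imp_continuous_within continuous_at_imp_continuous_on)
next
  case (Suc k)
  from Suc.prems have "\<forall>x. f differentiable (at x)" "\<And>v. C_k (Suc k) (ddir v f)"
    by simp_all
  then show ?case
    using Suc.IH by auto
qed

lemma C_k_add:
  assumes "C_k k f" "C_k k g"
  shows "C_k k (\<lambda>x. f x + g x)"
  using assms
proof (induction k arbitrary: f g)
  case 0
  then show ?case by (auto intro: continuous_intros)
next
  case (Suc k)
  have d: "((\<lambda>x. f x + g x) has_derivative
      (\<lambda>v. frechet_derivative f (at x) v + frechet_derivative g (at x) v)) (at x)" for x
    using Suc.prems by (auto intro!: derivative_intros simp: frechet_derivative_works[symmetric])
  have "ddir v (\<lambda>x. f x + g x) = (\<lambda>x. ddir v f x + ddir v g x)" for v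
    by (rule ext, subst ddir_eq[OF d]) (simp add: ddir_def)
  then show ?case
    using Suc differentiableI[OF d] by auto
qed

lemma C_k_mult:
  assumes "C_k k f" "C_k k g"
  shows "C_k k (\<lambda>x. f x * g x)"
  using assms
proof (induction k arbitrary: f g)
  case 0
  then show ?case by (auto intro: continuous_intros)
next
  case (Suc k)
  have d: "((\<lambda>x. f x * g x) has_derivative
      (\<lambda>v. f x * frechet_derivative g (at x) v + frechet_derivative f (at x) v * g x)) (at x)" for x
    using Suc.prems by (auto intro!: derivative_intros simp: frechet_derivative_works[symmetric])
  have "ddir v (\<lambda>x. f x * g x) = (\<lambda>x. f x * ddir v g x + ddir v f x * g x)" for v
    by (rule ext, subst ddir_eq[OF d]) (simp add: ddir_def)
  moreover have "C_k k f" "C_k k g"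
    using Suc.prems C_k_SucD by blast+
  ultimately show ?case
    using Suc.prems differentiableI[OF d] by (auto intro!: C_k_add Suc.IH)
qed

lemma C_k_const: "C_k k (\<lambda>x. c)"
proof (induction k arbitrary: c)
  case (Suc k)
  have "ddir v (\<lambda>x::'a. c) = (\<lambda>x. 0)" for v
    by (rule ext, subst ddir_eq[OF has_derivative_const]) simp
  then show ?case using Suc by simp
qed (simp add: continuous_on_const)

lemma C_k_linear_comp:
  assumes "bounded_linear L" "C_k k f"
  shows "C_k k (\<lambda>x. f (L x))"
  using assms(2)
proof (induction k arbitrary: f)
  case 0
  then show ?case
    using continuous_on_compose2[of UNIV f UNIV L, OF _ linear_continuous_on[OF assms(1)]] by simp
next
  case (Suc k)
  have d: "((\<lambda>x. f (L x)) has_derivative (\<lambda>v. frechet_derivative f (at (L x)) (L v))) (at x)" for x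
  proof -
    have "(L has_derivative L) (at x)"
      using assms(1) by (rule bounded_linear_imp_has_derivative)
    moreover have "(f has_derivative frechet_derivative f (at (L x))) (at (L x))"
      using Suc.prems by (simp add: frechet_derivative_works[symmetric])
    ultimately show ?thesis
      by (rule has_derivative_compose)
  qed
  have "ddir v (\<lambda>x. f (L x)) = (\<lambda>x. ddir (L v) f (L x))" for v
    by (rule ext, subst ddir_eq[OF d]) (simp add: ddir_def)
  then show ?case
    using Suc differentiableI[OF d] by auto
qed

lemma C_k_linear: "bounded_linear (L :: 'a::real_normed_vector \<Rightarrow> real) \<Longrightarrow> C_k k L"
proof (cases k)
  case (Suc m)
  assume L: "bounded_linear L"
  then have d: "(L has_derivative L) (at x)" for x
    by (rule bounded_linear_imp_has_derivative)
  have "ddir v L = (\<lambda>x. L v)" for v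
    by (rule ext, subst ddir_eq[OF d]) simp
  then show ?thesis using Suc differentiableI[OF d] by (auto simp: C_k_const)
qed (simp add: linear_continuous_on)

text \<open>
  The chain rule for a scalar function given together with all its derivatives: \<open>G n\<close> is the
  n-th derivative, and differentiating \<open>G n \<circ> f\<close> only produces \<open>G (Suc n) \<circ> f\<close>, so the
  induction closes. Restricting \<open>G\<close> to a set \<open>S\<close> that contains the values of \<open>f\<close> covers
  reciprocals and square roots of positive functions.
\<close>

lemma C_k_compose:
  fixes f :: "'a::real_normed_vector \<Rightarrow> real"
  assumes G: "\<And>n u. u \<in> S \<Longrightarrow> (G n has_real_derivative G (Suc n) u) (at u)"
    and S: "\<And>x. f x \<in> S" and f: "C_k k f"
  shows "C_k k (\<lambda>x. G n (f x))"
  using f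
proof (induction k arbitrary: n)
  case 0
  have "continuous_on S (G n)"
    using G by (meson DERIV_isCont continuous_at_imp_continuous_on)
  with 0 S show ?case
    by (auto intro!: continuous_on_compose2[of S "G n" UNIV f])
next
  case (Suc k)
  have d: "((\<lambda>x. G n (f x)) has_derivative
      (\<lambda>v. frechet_derivative f (at x) v * G (Suc n) (f x))) (at x)" for x
  proof -
    have "(f has_derivative frechet_derivative f (at x)) (at x)"
      using Suc.prems by (simp add: frechet_derivative_works[symmetric])
    from DERIV_compose_FDERIV[OF G[OF S[of x]] this] show ?thesis .
  qed
  have "ddir v (\<lambda>x. G n (f x)) = (\<lambda>x. ddir v f x * G (Suc n) (f x))" for v
    by (rule ext, subst ddir_eq[OF d]) (simp add: ddir_def)
  moreover have "C_k k f" using Suc.prems by (rule C_k_SucD)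
  ultimately show ?case
    using Suc differentiableI[OF d] by (auto intro!: C_k_mult)
qed

definition C_inf :: "('a::real_normed_vector \<Rightarrow> real) \<Rightarrow> bool" where
  "C_inf f \<longleftrightarrow> (\<forall>k. C_k k f)"

named_theorems C_inf_intros

lemma C_inf_const [C_inf_intros]: "C_inf (\<lambda>x. c)"
  by (simp add: C_inf_def C_k_const)

lemma C_inf_add [C_inf_intros]: "C_inf f \<Longrightarrow> C_inf g \<Longrightarrow> C_inf (\<lambda>x. f x + g x)"
  by (simp add: C_inf_def C_k_add)

lemma C_inf_mult [C_inf_intros]: "C_inf f \<Longrightarrow> C_inf g \<Longrightarrow> C_inf (\<lambda>x. f x * g x)"
  by (simp add: C_inf_def C_k_mult)

lemma C_inf_power [C_inf_intros]: "C_inf f \<Longrightarrow> C_inf (\<lambda>x. f x ^ m)"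
  by (induction m) (auto intro: C_inf_intros)

lemma C_inf_sum [C_inf_intros]: "(\<And>a. a \<in> A \<Longrightarrow> C_inf (f a)) \<Longrightarrow> C_inf (\<lambda>x. \<Sum>a\<in>A. f a x)"
  by (induction A rule: infinite_finite_induct) (auto intro: C_inf_intros)

lemma C_inf_linear_comp: "bounded_linear L \<Longrightarrow> C_inf f \<Longrightarrow> C_inf (\<lambda>x. f (L x))"
  by (simp add: C_inf_def C_k_linear_comp)

lemma C_inf_linear: "bounded_linear (L :: 'a::real_normed_vector \<Rightarrow> real) \<Longrightarrow> C_inf L"
  by (simp add: C_inf_def C_k_linear)

lemma C_inf_differentiable: "C_inf f \<Longrightarrow> f differentiable (at x)"
  unfolding C_inf_def by (metis C_k.simps(2))

lemma C_inf_has_derivative: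
  "C_inf f \<Longrightarrow> (f has_derivative (\<lambda>v. ddir v f x)) (at x)"
  using C_inf_differentiable[of f x] by (simp add: ddir_def frechet_derivative_works)

lemma C_inf_ddir: "C_inf f \<Longrightarrow> C_inf (ddir v f)"
  unfolding C_inf_def by (metis C_k.simps(2))

lemma C_inf_continuous: "C_inf f \<Longrightarrow> continuous_on A f"
  unfolding C_inf_def by (metis C_k.simps(1) continuous_on_subset subset_UNIV)

lemma C_inf_measurable: "C_inf f \<Longrightarrow> f \<in> borel_measurable borel"
  using C_inf_continuous borel_measurable_continuous_onI by blast

lemma C_inf_compose:
  assumes "\<And>n u. u \<in> S \<Longrightarrow> (G n has_real_derivative G (Suc n) u) (at u)"
    and "\<And>x. f x \<in> S" and "C_inf f"
  shows "C_inf (\<lambda>x. G n (f x))"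
  unfolding C_inf_def
proof
  fix k
  have "C_k k f" using assms(3) by (simp add: C_inf_def)
  with assms(1,2) show "C_k k (\<lambda>x. G n (f x))" by (rule C_k_compose)
qed

lemma C_inf_DERIV:
  assumes "C_inf (g :: real \<Rightarrow> real)"
  shows "(g has_real_derivative ddir 1 g u) (at u)"
proof -
  have d: "(g has_derivative frechet_derivative g (at u)) (at u)"
    using C_inf_differentiable[OF assms] by (simp add: frechet_derivative_works)
  then interpret bounded_linear "frechet_derivative g (at u)"
    by (rule has_derivative_bounded_linear)
  have "frechet_derivative g (at u) v = ddir 1 g u * v" for v
    using scaleR[of v 1] by (simp add: ddir_def)
  then have "frechet_derivative g (at u) = (\<lambda>v. ddir 1 g u * v)" ..
  with d show ?thesis
    by (simp add: has_field_derivative_def)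
qed

lemma C_inf_real_comp:
  fixes g :: "real \<Rightarrow> real"
  assumes g: "C_inf g" and f: "C_inf f"
  shows "C_inf (\<lambda>x. g (f x))"
proof -
  have "C_inf ((ddir 1 ^^ n) g)" for n
    by (induction n) (auto intro: g C_inf_ddir)
  then have "((ddir 1 ^^ n) g has_real_derivative (ddir 1 ^^ Suc n) g u) (at u)" for n u
    using C_inf_DERIV by simp
  from C_inf_compose[of UNIV "\<lambda>n. (ddir 1 ^^ n) g" f 0, OF this _ f] show ?thesis
    by simp
qed

text \<open>
  Only the exponents -1 (quotients in the cutoff function) and 1/2 (the gauge) matter below.
\<close>

lemma C_inf_powr:
  assumes f: "C_inf f" and pos: "\<And>x. f x > (0::real)"
  shows "C_inf (\<lambda>x. f x powr a)"
proof -
  define G where "G n = (\<lambda>u. (\<Prod>m<n. a - real m) * u powr (a - real n))" for n :: nat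
  have "(G n has_real_derivative G (Suc n) u) (at u)" if "u \<in> {0<..}" for n u
  proof -
    have "((\<lambda>u. u powr (a - real n)) has_real_derivative (a - real n) * u powr (a - real n - 1)) (at u)"
      using that by (intro has_real_derivative_powr) simp
    moreover have "a - real n - 1 = a - real (Suc n)" by simp
    ultimately have "((\<lambda>u. u powr (a - real n)) has_real_derivative
        (a - real n) * u powr (a - real (Suc n))) (at u)" by simp
    from DERIV_cmult[OF this, of "\<Prod>m<n. a - real m"] show ?thesis
      unfolding G_def prod.lessThan_Suc by (simp only: mult.assoc)
  qed
  from C_inf_compose[of "{0<..}" G f 0, OF this _ f] pos show ?thesis
    by (simp add: G_def)
qed

section \<open>A smooth cutoff function on the line\<close>

text \<open>
  For \<open>p = 1\<close> this is the flat function $e^{-1/u}$, extended by 0. The polynomial parameter makes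
  the family closed under differentiation.
\<close>

definition flat_family :: "real poly \<Rightarrow> real \<Rightarrow> real" where
  "flat_family p u = (if u \<le> 0 then 0 else poly p (inverse u) * exp (- inverse u))"

lemma poly_exp_decay: "((\<lambda>y. poly p y * exp (- y)) \<longlongrightarrow> 0) at_top" for p :: "real poly"
proof -
  have "((\<lambda>y. \<Sum>i\<le>degree p. coeff p i * (y ^ i / exp y)) \<longlongrightarrow> (\<Sum>i\<le>degree p. coeff p i * 0)) at_top"
    by (intro tendsto_intros tendsto_power_div_exp_0)
  moreover have "(\<Sum>i\<le>degree p. coeff p i * (y ^ i / exp y)) = poly p y * exp (- y)" for y
    by (simp add: poly_altdef sum_distrib_right exp_minus divide_inverse mult.assoc)
  ultimately show ?thesis by simp
qed

lemma flat_family_DERIV: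
  "(flat_family p has_real_derivative flat_family ([:0,0,1:] * (p - pderiv p)) u) (at u)"
proof -
  consider "u > 0" | "u < 0" | "u = 0" by linarith
  then show ?thesis
  proof cases
    case 1
    have inv: "((\<lambda>u. inverse u) has_real_derivative - (inverse u ^ 2)) (at u)"
      using DERIV_inverse[of u UNIV] 1 by (simp add: numeral_2_eq_2)
    have "((\<lambda>u. poly p (inverse u)) has_real_derivative
        poly (pderiv p) (inverse u) * (- (inverse u ^ 2))) (at u)"
      by (rule DERIV_chain2[OF poly_DERIV inv])
    moreover have "((\<lambda>u. exp (- inverse u)) has_real_derivative
        exp (- inverse u) * (- (- (inverse u ^ 2)))) (at u)"
      by (rule DERIV_chain2[OF DERIV_exp DERIV_minus[OF inv]])
    ultimately have "((\<lambda>u. poly p (inverse u) * exp (- inverse u)) has_real_derivative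
        poly (pderiv p) (inverse u) * (- (inverse u ^ 2)) * exp (- inverse u) +
        exp (- inverse u) * (- (- (inverse u ^ 2))) * poly p (inverse u)) (at u)"
      by (rule DERIV_mult)
    moreover have "poly (pderiv p) (inverse u) * (- (inverse u ^ 2)) * exp (- inverse u) +
        exp (- inverse u) * (- (- (inverse u ^ 2))) * poly p (inverse u) =
        flat_family ([:0,0,1:] * (p - pderiv p)) u"
      using 1 by (simp add: flat_family_def power2_eq_square) (simp add: algebra_simps)
    ultimately have "((\<lambda>u. poly p (inverse u) * exp (- inverse u)) has_real_derivative
        flat_family ([:0,0,1:] * (p - pderiv p)) u) (at u)"
      by simp
    moreover have "\<forall>\<^sub>F v in nhds u. flat_family p v = poly p (inverse v) * exp (- inverse v)"
      using eventually_nhds_in_open[of "{0<..}" u] 1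
      by (auto simp: flat_family_def elim!: eventually_mono)
    ultimately show ?thesis
      by (subst DERIV_cong_ev[OF refl _ refl]) auto
  next
    case 2
    have "((\<lambda>u. 0) has_real_derivative flat_family ([:0,0,1:] * (p - pderiv p)) u) (at u)"
      using 2 by (simp add: flat_family_def)
    moreover have "\<forall>\<^sub>F v in nhds u. flat_family p v = 0"
      using eventually_nhds_in_open[of "{..<0}" u] 2
      by (auto simp: flat_family_def elim!: eventually_mono)
    ultimately show ?thesis
      by (subst DERIV_cong_ev[OF refl _ refl]) auto
  next
    case 3
    have "((\<lambda>h. flat_family p h / h) \<longlongrightarrow> 0) (at 0)"
    proof (rule filterlim_split_at)
      have "\<forall>\<^sub>F h in at_left (0::real). flat_family p h / h = 0"
        by (auto simp: flat_family_def eventually_at_filter)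
      then show "((\<lambda>h. flat_family p h / h) \<longlongrightarrow> 0) (at_left 0)"
        by (rule tendsto_eventually)
      have "((\<lambda>h. poly (pCons 0 p) (inverse h) * exp (- inverse h)) \<longlongrightarrow> 0) (at_right 0)"
        by (rule filterlim_compose[OF poly_exp_decay filterlim_inverse_at_top_right])
      moreover have "\<forall>\<^sub>F h in at_right (0::real).
          poly (pCons 0 p) (inverse h) * exp (- inverse h) = flat_family p h / h"
        by (auto simp: flat_family_def eventually_at_filter field_simps)
      ultimately show "((\<lambda>h. flat_family p h / h) \<longlongrightarrow> 0) (at_right 0)"
        by (rule Lim_transform_eventually)
    qed
    then show ?thesis
      using 3 by (simp add: DERIV_def flat_family_def)
  qed
qed

lemma C_inf_flat: "C_inf (flat_family 1)"
proof -
  define P where "P n = ((\<lambda>p. [:0,0,1:] * (p - pderiv p)) ^^ n) (1 :: real poly)" for n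
  have "(flat_family (P n) has_real_derivative flat_family (P (Suc n)) u) (at u)" for n u
    unfolding P_def funpow.simps o_def by (rule flat_family_DERIV)
  from C_inf_compose[of UNIV "\<lambda>n. flat_family (P n)" "\<lambda>x::real. x" 0, OF this]
  have "C_inf (\<lambda>x. flat_family (P 0) x)"
    by (simp add: C_inf_linear bounded_linear_ident)
  then show ?thesis by (simp add: P_def)
qed

text \<open>
  Equal to 1 up to 1 and to 0 from 2 on. It truncates both in time and, composed with the gauge, in
  space.
\<close>

definition cutoff :: "real \<Rightarrow> real" where
  "cutoff u = flat_family 1 (2 - u) / (flat_family 1 (2 - u) + flat_family 1 (u - 1))"

lemma flat_nonneg: "flat_family 1 u \<ge> 0" and flat_pos: "flat_family 1 u > 0 \<longleftrightarrow> u > 0"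
  by (auto simp: flat_family_def)

lemma flat_denominator_pos: "flat_family 1 (2 - u) + flat_family 1 (u - 1) > 0"
  using flat_nonneg[of "2 - u"] flat_nonneg[of "u - 1"] flat_pos[of "2 - u"] flat_pos[of "u - 1"]
  by linarith

lemma cutoff_C_inf: "C_inf cutoff"
proof -
  have 1: "C_inf (\<lambda>u::real. a + b * u)" for a b
    by (intro C_inf_intros C_inf_linear bounded_linear_ident)
  have "C_inf (\<lambda>u. flat_family 1 (2 + (-1) * u))" "C_inf (\<lambda>u. flat_family 1 (-1 + 1 * u))"
    by (rule C_inf_real_comp[OF C_inf_flat 1])+
  then have 2: "C_inf (\<lambda>u. flat_family 1 (2 - u))" "C_inf (\<lambda>u. flat_family 1 (u - 1))"
    by simp_all
  have "C_inf (\<lambda>u. flat_family 1 (2 - u) *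
      (flat_family 1 (2 - u) + flat_family 1 (u - 1)) powr (-1))"
    by (intro C_inf_intros C_inf_powr 2 flat_denominator_pos)
  moreover have "(\<lambda>u. flat_family 1 (2 - u) *
      (flat_family 1 (2 - u) + flat_family 1 (u - 1)) powr (-1)) = cutoff"
    using flat_denominator_pos by (auto simp: cutoff_def powr_minus divide_inverse less_imp_le)
  ultimately show ?thesis by simp
qed

lemma cutoff_1: "u \<le> 1 \<Longrightarrow> cutoff u = 1"
  using flat_pos[of "2 - u"] by (auto simp: cutoff_def flat_family_def)

lemma cutoff_0: "u \<ge> 2 \<Longrightarrow> cutoff u = 0"
  by (auto simp: cutoff_def flat_family_def)

lemma cutoff_bounds: "0 \<le> cutoff u" "cutoff u \<le> 1"
  using flat_denominator_pos[of u] flat_nonneg[of "2 - u"] flat_nonneg[of "u - 1"]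
  by (auto simp: cutoff_def)

abbreviation "cutoff' \<equiv> ddir 1 cutoff"
abbreviation "cutoff'' \<equiv> ddir 1 cutoff'"

lemmas cutoff_DERIV = C_inf_DERIV[OF cutoff_C_inf]
lemmas cutoff'_C_inf = C_inf_ddir[OF cutoff_C_inf, of 1]
lemmas cutoff''_C_inf = C_inf_ddir[OF cutoff'_C_inf, of 1]

text \<open>
  On the open half-lines the function is locally constant; the end points follow by continuity of
  the derivative.
\<close>

lemma ddir_1_vanishes:
  fixes g :: "real \<Rightarrow> real"
  assumes g: "C_inf g" and c: "\<And>u. u < 1 \<Longrightarrow> g u = c" "\<And>u. u > 2 \<Longrightarrow> g u = d"
    and u: "u \<le> 1 \<or> u \<ge> 2"
  shows "ddir 1 g u = 0"
proof -
  have 1: "ddir 1 g v = 0" if "v < 1" for v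
  proof -
    have "\<forall>\<^sub>F w in nhds v. g w = c"
      using eventually_nhds_in_open[of "{..<1}" v] that by (auto elim!: eventually_mono simp: c)
    then have "(g has_real_derivative 0) (at v)"
      by (subst DERIV_cong_ev[OF refl _ refl]) auto
    then show ?thesis using C_inf_DERIV[OF g] DERIV_unique by blast
  qed
  have 2: "ddir 1 g v = 0" if "v > 2" for v
  proof -
    have "\<forall>\<^sub>F w in nhds v. g w = d"
      using eventually_nhds_in_open[of "{2<..}" v] that by (auto elim!: eventually_mono simp: c)
    then have "(g has_real_derivative 0) (at v)"
      by (subst DERIV_cong_ev[OF refl _ refl]) auto
    then show ?thesis using C_inf_DERIV[OF g] DERIV_unique by blast
  qed
  have "isCont (ddir 1 g) u"
    using C_inf_continuous[OF C_inf_ddir[OF g], of UNIV 1] by (simp add: continuous_on_eq_continuous_at)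
  then have lim: "(ddir 1 g \<longlongrightarrow> ddir 1 g u) (at u)"
    by (simp add: isCont_def)
  consider "u < 1" | "u > 2" | "u = 1" | "u = 2" using u by linarith
  then show ?thesis
  proof cases
    case 3
    have "(ddir 1 g \<longlongrightarrow> 0) (at_left 1)"
      by (rule tendsto_eventually) (auto simp: eventually_at_filter 1)
    moreover have "(ddir 1 g \<longlongrightarrow> ddir 1 g u) (at_left 1)"
      using lim 3 by (simp add: filterlim_at_split)
    ultimately show ?thesis
      using tendsto_unique[OF trivial_limit_at_left_real] by blast
  next
    case 4
    have "(ddir 1 g \<longlongrightarrow> 0) (at_right 2)"
      by (rule tendsto_eventually) (auto simp: eventually_at_filter 2)
    moreover have "(ddir 1 g \<longlongrightarrow> ddir 1 g u) (at_right 2)"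
      using lim 4 by (simp add: filterlim_at_split)
    ultimately show ?thesis
      using tendsto_unique[OF trivial_limit_at_right_real] by blast
  qed (use 1 2 in auto)
qed

lemma cutoff'_0: "u \<le> 1 \<or> u \<ge> 2 \<Longrightarrow> cutoff' u = 0"
  by (rule ddir_1_vanishes[OF cutoff_C_inf, of 1 0]) (auto simp: cutoff_1 cutoff_0)

lemma cutoff''_0: "u \<le> 1 \<or> u \<ge> 2 \<Longrightarrow> cutoff'' u = 0"
  by (rule ddir_1_vanishes[OF cutoff'_C_inf, of 0 0]) (auto simp: cutoff'_0)

lemma cutoff_derivs_bounded:
  obtains D where "\<And>u. \<bar>cutoff' u\<bar> \<le> D" "\<And>u. \<bar>cutoff'' u\<bar> \<le> D" "D \<ge> 1"
proof -
  have *: "\<exists>D. \<forall>u. \<bar>g u\<bar> \<le> D" if "C_inf g" "\<And>u. u \<le> 1 \<or> u \<ge> 2 \<Longrightarrow> g u = 0" for g :: "real \<Rightarrow> real"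
  proof -
    have "bounded (g ` {1..2})"
      by (intro compact_imp_bounded compact_continuous_image C_inf_continuous that compact_Icc)
    then obtain D where "\<forall>u\<in>{1..2}. \<bar>g u\<bar> \<le> D" by (auto simp: bounded_iff)
    then have "\<bar>g u\<bar> \<le> max D 0" for u
      using that(2)[of u] by (cases "u \<in> {1..2}") (auto simp: max.coboundedI1)
    then show ?thesis by blast
  qed
  obtain D1 D2 where D: "\<And>u. \<bar>cutoff' u\<bar> \<le> D1" "\<And>u. \<bar>cutoff'' u\<bar> \<le> D2"
    using *[OF cutoff'_C_inf cutoff'_0] *[OF cutoff''_C_inf cutoff''_0] by blast
  show ?thesis
    by (rule that[of "max 1 (max D1 D2)"]) (use D in \<open>auto simp: max.coboundedI1 max.coboundedI2\<close>)
qed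

section \<open>The horizontal fields and their product rules\<close>

text \<open>
  \<open>hfield\<close> treats the fields $X_j$ and $Y_j$ uniformly: the i-th field differentiates along the
  i-th coordinate axis tilted into the centre with slope \<open>twist i\<close>. \<open>hlap\<close> is the sum of their
  squares, so $-\mathcal{L}$, and \<open>hgamma\<close> is its carre du champ.
\<close>

definition twist :: "'n + 'n \<Rightarrow> 'n::finite heis \<Rightarrow> real" where
  "twist i x = (case i of Inl j \<Rightarrow> - 1/2 * fst x $ Inr j | Inr j \<Rightarrow> 1/2 * fst x $ Inl j)"

definition hfield :: "'n + 'n \<Rightarrow> ('n::finite heis \<Rightarrow> real) \<Rightarrow> 'n heis \<Rightarrow> real" where
  "hfield i f x = pd i f x + twist i x * pd_last f x"

definition hlap :: "('n::finite heis \<Rightarrow> real) \<Rightarrow> 'n heis \<Rightarrow> real" where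
  "hlap f x = (\<Sum>i\<in>UNIV. hfield i (hfield i f) x)"

definition hgamma :: "('n::finite heis \<Rightarrow> real) \<Rightarrow> ('n heis \<Rightarrow> real) \<Rightarrow> 'n heis \<Rightarrow> real" where
  "hgamma f g x = (\<Sum>i\<in>UNIV. hfield i f x * hfield i g x)"

lemma sum_UNIV_sum: "(\<Sum>i\<in>UNIV. f i) = (\<Sum>j\<in>UNIV. f (Inl j)) + (\<Sum>j\<in>UNIV. f (Inr j))"
  for f :: "'a::finite + 'b::finite \<Rightarrow> 'c::comm_monoid_add"
  by (subst UNIV_Plus_UNIV[symmetric], subst sum.Plus) simp_all

lemma sublaplacian_eq_hlap: "sublaplacian f x = - hlap f x"
proof -
  have "X_field j = hfield (Inl j)" "Y_field j = hfield (Inr j)" for j :: 'a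
    by (simp_all add: fun_eq_iff X_field_def Y_field_def hfield_def twist_def)
  then show ?thesis
    by (simp add: sublaplacian_def hlap_def sum_UNIV_sum sum.distrib)
qed

lemma hfield_eq:
  assumes "(f has_derivative D) (at x)"
  shows "hfield i f x = D (axis i 1, twist i x)"
proof -
  interpret bounded_linear D using assms by (rule has_derivative_bounded_linear)
  have "(axis i (1::real), twist i x) = (axis i 1, 0) + twist i x *\<^sub>R (0, 1)"
    by simp
  then have "D (axis i 1, twist i x) = D (axis i 1, 0) + twist i x * D (0, 1)"
    by (simp only: add scaleR real_scaleR_def)
  then show ?thesis
    by (simp add: hfield_def pd_def pd_last_def ddir_eq[OF assms])
qed

lemma bounded_linear_coord: "bounded_linear (\<lambda>x::'n::finite heis. fst x $ i)"
  by (rule bounded_linear_compose[OF bounded_linear_vec_nth bounded_linear_fst])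

lemma C_inf_coord [C_inf_intros]: "C_inf (\<lambda>x::'n::finite heis. fst x $ i)"
  by (rule C_inf_linear) (rule bounded_linear_coord)

lemma C_inf_snd [C_inf_intros]: "C_inf (\<lambda>x::'n::finite heis. snd x)"
  by (rule C_inf_linear) (rule bounded_linear_snd)

lemma C_inf_twist [C_inf_intros]: "C_inf (twist i)"
  unfolding twist_def by (cases i) (simp_all only: sum.case C_inf_mult C_inf_const C_inf_coord)

lemma C_inf_hfield: "C_inf f \<Longrightarrow> C_inf (hfield i f)"
  unfolding hfield_def[abs_def] pd_def pd_last_def
  by (intro C_inf_intros C_inf_ddir)

lemma C_inf_hlap: "C_inf f \<Longrightarrow> C_inf (hlap f)"
  unfolding hlap_def[abs_def] by (intro C_inf_intros C_inf_hfield)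

lemma hfield_add:
  assumes "C_inf f" "C_inf g"
  shows "hfield i (\<lambda>x. f x + g x) = (\<lambda>x. hfield i f x + hfield i g x)"
proof
  fix x
  note d = assms[THEN C_inf_has_derivative, of x]
  show "hfield i (\<lambda>x. f x + g x) x = hfield i f x + hfield i g x"
    unfolding hfield_eq[OF d(1)] hfield_eq[OF d(2)] hfield_eq[OF has_derivative_add[OF d]] ..
qed

lemma hfield_mult:
  assumes "C_inf f" "C_inf g"
  shows "hfield i (\<lambda>x. f x * g x) = (\<lambda>x. f x * hfield i g x + hfield i f x * g x)"
proof
  fix x
  note d = assms[THEN C_inf_has_derivative, of x]
  show "hfield i (\<lambda>x. f x * g x) x = f x * hfield i g x + hfield i f x * g x"
    unfolding hfield_eq[OF d(1)] hfield_eq[OF d(2)] hfield_eq[OF has_derivative_mult[OF d]] ..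
qed

lemma hfield_const [simp]: "hfield i (\<lambda>x. c) = (\<lambda>x. 0)"
proof
  fix x show "hfield i (\<lambda>x. c) x = 0"
    unfolding hfield_eq[OF has_derivative_const] ..
qed

lemma hfield_compose:
  assumes g: "C_inf (g :: real \<Rightarrow> real)" and f: "C_inf f"
  shows "hfield i (\<lambda>x. g (f x)) = (\<lambda>x. ddir 1 g (f x) * hfield i f x)"
proof
  fix x
  note d = C_inf_has_derivative[OF f, of x]
  show "hfield i (\<lambda>x. g (f x)) x = ddir 1 g (f x) * hfield i f x"
    unfolding hfield_eq[OF d] hfield_eq[OF DERIV_compose_FDERIV[OF C_inf_DERIV[OF g] d]]
    by (rule mult.commute)
qed

lemma hlap_add:
  assumes "C_inf f" "C_inf g"
  shows "hlap (\<lambda>x. f x + g x) = (\<lambda>x. hlap f x + hlap g x)"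
  by (simp add: hlap_def fun_eq_iff hfield_add assms C_inf_hfield sum.distrib)

lemma hlap_const [simp]: "hlap (\<lambda>x. c) = (\<lambda>x. 0)"
  by (simp add: hlap_def fun_eq_iff)

lemma hlap_mult:
  assumes "C_inf f" "C_inf g"
  shows "hlap (\<lambda>x. f x * g x) = (\<lambda>x. f x * hlap g x + hlap f x * g x + 2 * hgamma f g x)"
proof
  fix x
  have "hlap (\<lambda>x. f x * g x) x = (\<Sum>i\<in>UNIV. f x * hfield i (hfield i g) x
      + hfield i (hfield i f) x * g x + 2 * (hfield i f x * hfield i g x))"
    unfolding hlap_def
    by (intro sum.cong refl)
      (simp add: hfield_mult hfield_add assms C_inf_hfield C_inf_mult algebra_simps)
  then show "hlap (\<lambda>x. f x * g x) x = f x * hlap g x + hlap f x * g x + 2 * hgamma f g x"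
    by (simp add: hlap_def hgamma_def sum.distrib sum_distrib_left sum_distrib_right)
qed

lemma hlap_compose:
  assumes g: "C_inf (g :: real \<Rightarrow> real)" and f: "C_inf f"
  shows "hlap (\<lambda>x. g (f x)) = (\<lambda>x. ddir 1 g (f x) * hlap f x + ddir 1 (ddir 1 g) (f x) * hgamma f f x)"
proof
  fix x
  note g' = C_inf_ddir[OF g, of 1]
  have "hfield i (hfield i (\<lambda>x. g (f x))) x = ddir 1 g (f x) * hfield i (hfield i f) x
      + ddir 1 (ddir 1 g) (f x) * (hfield i f x * hfield i f x)" for i
    by (subst hfield_compose[OF g f], subst hfield_mult[OF C_inf_real_comp[OF g' f] C_inf_hfield[OF f]],
      subst hfield_compose[OF g' f]) (simp only: mult.assoc)
  then show "hlap (\<lambda>x. g (f x)) x = ddir 1 g (f x) * hlap f x + ddir 1 (ddir 1 g) (f x) * hgamma f f x"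
    by (simp add: hlap_def hgamma_def sum.distrib sum_distrib_left)
qed

lemma hfield_cmult: "C_inf f \<Longrightarrow> hfield i (\<lambda>x. c * f x) = (\<lambda>x. c * hfield i f x)"
  by (simp add: hfield_mult C_inf_const)

lemma hlap_cmult: "C_inf f \<Longrightarrow> hlap (\<lambda>x. c * f x) = (\<lambda>x. c * hlap f x)"
  by (simp add: hlap_mult C_inf_const hgamma_def)

lemma hfield_coord: "hfield i (\<lambda>x. fst x $ j) = (\<lambda>x. if i = j then 1 else 0)"
proof
  fix x
  show "hfield i (\<lambda>x. fst x $ j) x = (if i = j then 1 else 0)"
    by (subst hfield_eq[OF bounded_linear_imp_has_derivative[OF bounded_linear_coord]])
      (simp add: axis_def)
qed

lemma hfield_snd: "hfield i snd = twist i"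
proof
  fix x
  show "hfield i snd x = twist i x"
    by (subst hfield_eq[OF bounded_linear_imp_has_derivative[OF bounded_linear_snd]]) simp
qed

text \<open>
  The slope of a field depends only on the conjugate coordinate, along which the field does not
  move; this is why the central coordinate is annihilated by \<open>hlap\<close>.
\<close>

lemma hfield_twist_self: "hfield i (twist i) = (\<lambda>x. 0)"
proof (cases i)
  case (Inl j)
  then have "twist i = (\<lambda>x. (- 1/2) * fst x $ Inr j)" by (simp add: twist_def fun_eq_iff)
  then show ?thesis
    using Inl by (simp only: hfield_cmult[OF C_inf_coord] hfield_coord) simp
next
  case (Inr j)
  then have "twist i = (\<lambda>x. (1/2) * fst x $ Inl j)" by (simp add: twist_def fun_eq_iff)
  then show ?thesis
    using Inr by (simp only: hfield_cmult[OF C_inf_coord] hfield_coord) simp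
qed

lemma hlap_coord: "hlap (\<lambda>x. fst x $ j) = (\<lambda>x. 0)"
  by (rule ext) (simp add: hlap_def hfield_coord)

lemma hlap_snd: "hlap snd = (\<lambda>x. 0)"
  by (rule ext) (simp add: hlap_def hfield_snd hfield_twist_self)

section \<open>A homogeneous gauge and functions of bounded weight\<close>

text \<open>
  The group dilations give weight 1 to the horizontal coordinates and weight 2 to the central one.
  \<open>hgauge\<close> has weight 1 and is at least 1; its square \<open>hgauge2\<close> is the lowest power of it that
  needs to be smooth, since the moments are climbed two weights at a time.
\<close>

definition hgauge4 :: "'n::finite heis \<Rightarrow> real" where
  "hgauge4 x = 1 + (\<Sum>i\<in>UNIV. (fst x $ i) * (fst x $ i)) * (\<Sum>i\<in>UNIV. (fst x $ i) * (fst x $ i)) + snd x * snd x"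

definition hgauge2 :: "'n::finite heis \<Rightarrow> real" where
  "hgauge2 x = hgauge4 x powr (1/2)"

definition hgauge :: "'n::finite heis \<Rightarrow> real" where
  "hgauge x = sqrt (hgauge2 x)"

lemma hgauge4_ge_1: "hgauge4 x \<ge> 1"
  by (simp add: hgauge4_def)

lemma hgauge2_ge_1: "hgauge2 x \<ge> 1"
  unfolding hgauge2_def using hgauge4_ge_1 by (rule ge_one_powr_ge_zero) simp

lemma hgauge_ge_1: "hgauge x \<ge> 1"
  using hgauge2_ge_1 by (simp add: hgauge_def)

lemma hgauge_sq: "hgauge x ^ 2 = hgauge2 x"
  using hgauge2_ge_1[of x] by (simp add: hgauge_def)

lemma hgauge2_sq: "hgauge2 x * hgauge2 x = hgauge4 x"
  using hgauge4_ge_1[of x] by (simp add: hgauge2_def powr_half_sqrt)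

lemma hgauge2_0 [simp]: "hgauge2 0 = 1"
  by (simp add: hgauge2_def hgauge4_def)

lemma hgauge_pow4: "hgauge x ^ 4 = hgauge4 x"
proof -
  have "hgauge x ^ 4 = hgauge x ^ 2 * hgauge x ^ 2" by (simp add: power_add[symmetric])
  then show ?thesis by (simp add: hgauge_sq hgauge2_sq)
qed

lemma coord_le_hgauge: "\<bar>fst x $ i\<bar> \<le> hgauge x"
proof -
  let ?S = "\<Sum>i\<in>UNIV. (fst x $ i) * (fst x $ i)"
  have 1: "(fst x $ i) * (fst x $ i) \<le> ?S"
    by (rule member_le_sum) auto
  have 2: "0 \<le> (fst x $ i) * (fst x $ i)" by simp
  have "\<bar>fst x $ i\<bar> ^ 4 = ((fst x $ i) * (fst x $ i)) * ((fst x $ i) * (fst x $ i))"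
    by (simp add: power4_eq_xxxx mult.assoc)
  also have "\<dots> \<le> ?S * ?S" using 1 2 by (intro mult_mono sum_nonneg) auto
  also have "\<dots> \<le> hgauge x ^ 4"
    unfolding hgauge_pow4 hgauge4_def using zero_le_square[of "snd x"] by linarith
  finally show ?thesis
    using hgauge_ge_1[of x] by (subst (asm) power_mono_iff) auto
qed

lemma snd_le_hgauge: "\<bar>snd x\<bar> \<le> hgauge x ^ 2"
proof -
  have "snd x * snd x \<le> hgauge4 x"
    unfolding hgauge4_def using zero_le_square[of "\<Sum>i\<in>UNIV. (fst x $ i) * (fst x $ i)"] by linarith
  also have "\<dots> = (hgauge x ^ 2) ^ 2"
    by (simp add: hgauge_pow4[symmetric])
  finally have "\<bar>snd x\<bar> ^ 2 \<le> (hgauge x ^ 2) ^ 2"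
    by (simp add: power2_eq_square)
  then show ?thesis
    by (rule power2_le_imp_le) simp
qed

text \<open>
  A function of weight k, with the smoothness and the decay gained under differentiation: a
  horizontal derivative lowers the weight by 1 and \<open>hlap\<close> lowers it by 2. The inequalities are
  multiplied by powers of \<open>hgauge\<close> so that no negative exponents occur for small k. The constant
  is explicit because uniformity in the cutoff radius is essential.
\<close>

definition weighted :: "nat \<Rightarrow> real \<Rightarrow> ('n::finite heis \<Rightarrow> real) \<Rightarrow> bool" where
  "weighted k C f \<longleftrightarrow> C_inf f \<and> (\<forall>x. \<bar>f x\<bar> \<le> C * hgauge x ^ k) \<and>
     (\<forall>x i. \<bar>hfield i f x\<bar> * hgauge x \<le> C * hgauge x ^ k) \<and>
     (\<forall>x. \<bar>hlap f x\<bar> * hgauge x ^ 2 \<le> C * hgauge x ^ k)"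

lemma weightedD:
  assumes "weighted k C f"
  shows "C_inf f" "\<bar>f x\<bar> \<le> C * hgauge x ^ k" "\<bar>hfield i f x\<bar> * hgauge x \<le> C * hgauge x ^ k"
    "\<bar>hlap f x\<bar> * hgauge x ^ 2 \<le> C * hgauge x ^ k" "C \<ge> 0"
proof -
  show 1: "\<bar>f x\<bar> \<le> C * hgauge x ^ k" for x
    using assms unfolding weighted_def by blast
  have "0 \<le> C * hgauge (0::'a heis) ^ k" using 1[of 0] by linarith
  moreover have "hgauge (0::'a heis) ^ k > 0" using hgauge_ge_1[of "0::'a heis"] by simp
  ultimately show "C \<ge> 0" by (simp add: zero_le_mult_iff)
qed (use assms[unfolded weighted_def] in blast)+

lemma weighted_mono:
  assumes f: "weighted k C f" and le: "k \<le> l" "C \<le> D"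
  shows "weighted l D f"
proof -
  have *: "C * hgauge x ^ k \<le> D * hgauge x ^ l" for x :: "'a heis"
    using le weightedD(5)[OF f] hgauge_ge_1[of x] by (intro mult_mono power_increasing) auto
  show ?thesis
    unfolding weighted_def using weightedD(1-4)[OF f] * by (meson order_trans)
qed

lemma weighted_const: "weighted k \<bar>c\<bar> (\<lambda>x. c)"
proof -
  have "weighted 0 \<bar>c\<bar> (\<lambda>x. c)"
    by (auto simp: weighted_def C_inf_const)
  then show ?thesis by (rule weighted_mono) auto
qed

lemma weighted_coord: "weighted 1 1 (\<lambda>x. fst x $ i)"
  unfolding weighted_def hfield_coord hlap_coord
proof (intro conjI allI)
  fix x :: "'a heis" and j
  show "\<bar>if j = i then 1 else 0\<bar> * hgauge x \<le> 1 * hgauge x ^ 1"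
    "\<bar>0\<bar> * (hgauge x)\<^sup>2 \<le> 1 * hgauge x ^ 1"
    using hgauge_ge_1[of x] by simp_all
  show "\<bar>fst x $ i\<bar> \<le> 1 * hgauge x ^ 1" using coord_le_hgauge[of x i] by simp
qed (rule C_inf_coord)

lemma weighted_snd: "weighted 2 1 snd"
proof -
  have "\<bar>twist i x\<bar> * hgauge x \<le> hgauge x ^ 2" for i and x :: "'a heis"
  proof -
    have "\<bar>twist i x\<bar> \<le> hgauge x"
      using coord_le_hgauge[of x] hgauge_ge_1[of x]
      by (cases i) (fastforce simp: twist_def abs_mult intro: order_trans)+
    then show ?thesis
      using hgauge_ge_1[of x] by (simp add: power2_eq_square mult_right_mono)
  qed
  then show ?thesis
    using snd_le_hgauge by (auto simp: weighted_def C_inf_snd hfield_snd hlap_snd)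
qed

lemma weighted_add:
  assumes f: "weighted k C f" and g: "weighted k D g"
  shows "weighted k (C + D) (\<lambda>x. f x + g x)"
  unfolding weighted_def
proof (intro conjI allI)
  note F = weightedD[OF f] and G = weightedD[OF g]
  show "C_inf (\<lambda>x. f x + g x)" by (intro C_inf_intros F G)
  fix x i
  show "\<bar>f x + g x\<bar> \<le> (C + D) * hgauge x ^ k"
    using F(2)[of x] G(2)[of x] by (simp add: distrib_right)
  have *: "\<bar>a + b\<bar> * c \<le> (C + D) * e" if "\<bar>a\<bar> * c \<le> C * e" "\<bar>b\<bar> * c \<le> D * e" "c \<ge> 0" for a b c e
  proof -
    have "\<bar>a + b\<bar> * c \<le> (\<bar>a\<bar> + \<bar>b\<bar>) * c" using that by (intro mult_right_mono) auto
    with that show ?thesis by (simp add: distrib_right)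
  qed
  show "\<bar>hfield i (\<lambda>x. f x + g x) x\<bar> * hgauge x \<le> (C + D) * hgauge x ^ k"
    using *[OF F(3)[of i x] G(3)[of i x]] hgauge_ge_1[of x]
    by (simp add: hfield_add[OF F(1) G(1)])
  show "\<bar>hlap (\<lambda>x. f x + g x) x\<bar> * (hgauge x)\<^sup>2 \<le> (C + D) * hgauge x ^ k"
    using *[OF F(4)[of x] G(4)[of x]]
    by (simp add: hlap_add[OF F(1) G(1)])
qed

lemma hgamma_bound:
  fixes x :: "'n::finite heis"
  assumes "\<And>i. \<bar>hfield i f x\<bar> * hgauge x \<le> a" "\<And>i. \<bar>hfield i g x\<bar> * hgauge x \<le> b"
  shows "\<bar>hgamma f g x\<bar> * hgauge x ^ 2 \<le> real CARD('n + 'n) * (a * b)"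
proof -
  have "\<bar>hgamma f g x\<bar> * hgauge x ^ 2 \<le> (\<Sum>i\<in>UNIV. \<bar>hfield i f x * hfield i g x\<bar>) * hgauge x ^ 2"
    unfolding hgamma_def by (intro mult_right_mono sum_abs) simp
  also have "\<dots> = (\<Sum>i\<in>UNIV. (\<bar>hfield i f x\<bar> * hgauge x) * (\<bar>hfield i g x\<bar> * hgauge x))"
    by (simp add: sum_distrib_right sum_distrib_left abs_mult power2_eq_square mult_ac)
  also have "\<dots> \<le> (\<Sum>i::'n + 'n\<in>UNIV. a * b)"
    using hgauge_ge_1[of x] order_trans[OF _ assms(1)]
    by (intro sum_mono mult_mono assms) auto
  finally show ?thesis by simp
qed

text \<open>
  Weights add up because \<open>hlap (f * g)\<close> consists of \<open>f * hlap g\<close>, \<open>g * hlap f\<close> and products of one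
  horizontal derivative of each factor, all of which have lost two weights in total.
\<close>

lemma weighted_mult:
  fixes f g :: "'n::finite heis \<Rightarrow> real"
  assumes f: "weighted k C f" and g: "weighted l D g"
  shows "weighted (k + l) ((2 + 2 * real CARD('n + 'n)) * (C * D)) (\<lambda>x. f x * g x)"
  unfolding weighted_def
proof (intro conjI allI)
  note F = weightedD[OF f] and G = weightedD[OF g]
  let ?N = "real CARD('n + 'n)"
  show "C_inf (\<lambda>x. f x * g x)" by (intro C_inf_intros F G)
  fix x :: "'n heis" and i
  define A B where "A = C * hgauge x ^ k" and "B = D * hgauge x ^ l"
  have nn: "A \<ge> 0" "B \<ge> 0" "A * B \<ge> 0" "?N * (A * B) \<ge> 0"
    using F(5) G(5) hgauge_ge_1[of x] by (auto simp: A_def B_def)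
  have AB: "(2 + 2 * ?N) * (C * D) * hgauge x ^ (k + l) = (2 + 2 * ?N) * (A * B)"
    by (simp add: A_def B_def power_add)
  note F' = F(2-4)[where x=x, folded A_def] and G' = G(2-4)[where x=x, folded B_def]
  have fg: "\<bar>f x * g x\<bar> \<le> A * B"
    unfolding abs_mult using F' G' nn by (intro mult_mono) auto
  show "\<bar>f x * g x\<bar> \<le> (2 + 2 * ?N) * (C * D) * hgauge x ^ (k + l)"
    unfolding AB using fg mult_right_mono[of 1 "2 + 2 * ?N" "A * B"] nn by simp
  have 2: "\<bar>f x * b + a * g x\<bar> * c \<le> 2 * (A * B)"
    if "\<bar>a\<bar> * c \<le> A" "\<bar>b\<bar> * c \<le> B" "c \<ge> 0" for a b c
  proof -
    have "\<bar>f x * b + a * g x\<bar> * c \<le> (\<bar>f x\<bar> * \<bar>b\<bar> + \<bar>a\<bar> * \<bar>g x\<bar>) * c"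
      unfolding abs_mult[symmetric] using that(3) by (intro mult_right_mono abs_triangle_ineq)
    also have "\<dots> = \<bar>f x\<bar> * (\<bar>b\<bar> * c) + (\<bar>a\<bar> * c) * \<bar>g x\<bar>" by (simp add: algebra_simps)
    also have "\<dots> \<le> A * B + A * B"
      by (intro add_mono mult_mono F'(1) G'(1) that nn) (use that(3) in simp_all)
    finally show ?thesis by simp
  qed
  show "\<bar>hfield i (\<lambda>x. f x * g x) x\<bar> * hgauge x \<le> (2 + 2 * ?N) * (C * D) * hgauge x ^ (k + l)"
    unfolding AB hfield_mult[OF F(1) G(1)]
    using 2[OF F'(2)[of i] G'(2)[of i]] hgauge_ge_1[of x] mult_right_mono[of 2 "2 + 2 * ?N" "A * B"] nn
    by simp
  have "\<bar>hlap (\<lambda>x. f x * g x) x\<bar> * hgauge x ^ 2 \<le>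
      \<bar>f x * hlap g x + hlap f x * g x\<bar> * hgauge x ^ 2 + 2 * (\<bar>hgamma f g x\<bar> * hgauge x ^ 2)"
    unfolding hlap_mult[OF F(1) G(1)]
    by (subst mult.assoc[symmetric], subst distrib_right[symmetric], intro mult_right_mono) auto
  also have "\<dots> \<le> 2 * (A * B) + 2 * (?N * (A * B))"
    by (intro add_mono mult_left_mono 2 hgamma_bound F' G') auto
  finally show "\<bar>hlap (\<lambda>x. f x * g x) x\<bar> * hgauge x ^ 2 \<le> (2 + 2 * ?N) * (C * D) * hgauge x ^ (k + l)"
    unfolding AB by (simp add: distrib_right)
qed

definition of_weight :: "nat \<Rightarrow> ('n::finite heis \<Rightarrow> real) \<Rightarrow> bool" where
  "of_weight k f \<longleftrightarrow> (\<exists>C. weighted k C f)"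

lemma of_weight_const: "of_weight k (\<lambda>x. c)"
  and of_weight_coord: "of_weight 1 (\<lambda>x. fst x $ i)"
  and of_weight_snd: "of_weight 2 snd"
  and of_weight_add: "of_weight k f \<Longrightarrow> of_weight k g \<Longrightarrow> of_weight k (\<lambda>x. f x + g x)"
  and of_weight_mult: "of_weight k f \<Longrightarrow> of_weight l g \<Longrightarrow> of_weight (k + l) (\<lambda>x. f x * g x)"
  and of_weight_mono: "of_weight k f \<Longrightarrow> k \<le> l \<Longrightarrow> of_weight l f"
  unfolding of_weight_def
  using weighted_const weighted_coord weighted_snd weighted_add weighted_mult weighted_mono[OF _ _ order_refl]
  by blast+

lemma of_weight_sum:
  "(\<And>a. a \<in> A \<Longrightarrow> of_weight k (f a)) \<Longrightarrow> of_weight k (\<lambda>x. \<Sum>a\<in>A. f a x)"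
  by (induction A rule: infinite_finite_induct) (auto intro: of_weight_const of_weight_add)

lemma of_weight_hgauge4: "of_weight 4 hgauge4"
proof -
  have *: "of_weight 2 (\<lambda>x. fst x $ i * fst x $ i)" for i :: "'a + 'a"
    using of_weight_mult[OF of_weight_coord of_weight_coord, of i i] by (simp add: numeral_2_eq_2)
  have "of_weight (2 + 2) (\<lambda>x. (\<Sum>i\<in>UNIV. fst x $ i * fst x $ i) * (\<Sum>i::'a + 'a\<in>UNIV. fst x $ i * fst x $ i))"
    by (intro of_weight_mult of_weight_sum *)
  moreover have "of_weight (2 + 2) (\<lambda>x::'a heis. snd x * snd x)"
    by (intro of_weight_mult of_weight_snd)
  ultimately show ?thesis
    unfolding hgauge4_def[abs_def] by (intro of_weight_add of_weight_const) simp_all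
qed

lemma C_inf_hgauge2: "C_inf hgauge2"
  unfolding hgauge2_def[abs_def]
proof (rule C_inf_powr)
  show "C_inf (hgauge4 :: 'a heis \<Rightarrow> real)"
    using of_weight_hgauge4 weightedD(1) unfolding of_weight_def by blast
  show "hgauge4 x > 0" for x :: "'a heis" using hgauge4_ge_1[of x] by simp
qed

text \<open>
  Differentiating \<open>hgauge2 * hgauge2 = hgauge4\<close> by the product rule bounds the derivatives of the
  square root without computing them: the polynomial \<open>hgauge4\<close> has weight 4 and the first-order
  bound, obtained first, controls the carre du champ in the second-order identity.
\<close>

lemma of_weight_hgauge2: "of_weight 2 (hgauge2 :: 'n::finite heis \<Rightarrow> real)"
proof -
  obtain C where C: "weighted 4 C (hgauge4 :: 'n heis \<Rightarrow> real)"
    using of_weight_hgauge4 unfolding of_weight_def by blast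
  note C' = weightedD[OF C]
  let ?N = "real CARD('n + 'n)"
  have eq: "hgauge4 = (\<lambda>x::'n heis. hgauge2 x * hgauge2 x)"
    by (simp add: hgauge2_sq)
  have h1: "\<bar>hfield i hgauge2 x\<bar> * hgauge x \<le> C / 2 * hgauge x ^ 2" for i and x :: "'n heis"
  proof -
    have "hfield i hgauge4 x = 2 * hgauge2 x * hfield i hgauge2 x"
      by (subst eq, subst hfield_mult[OF C_inf_hgauge2 C_inf_hgauge2]) simp
    then have "2 * hgauge2 x * (\<bar>hfield i hgauge2 x\<bar> * hgauge x) \<le> C * hgauge x ^ 4"
      using C'(3)[of i x] hgauge2_ge_1[of x] by (simp add: abs_mult mult.assoc)
    also have "\<dots> = 2 * hgauge2 x * (C / 2 * hgauge x ^ 2)"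
      by (simp add: hgauge_pow4 hgauge_sq hgauge2_sq[symmetric])
    finally show ?thesis
      using hgauge2_ge_1[of x] by (subst (asm) mult_le_cancel_left_pos) auto
  qed
  have h2: "\<bar>hlap hgauge2 x\<bar> * hgauge x ^ 2 \<le> (C / 2 + ?N * (C / 2 * (C / 2))) * hgauge x ^ 2" for x :: "'n heis"
  proof -
    have "hlap hgauge4 x = 2 * hgauge2 x * hlap hgauge2 x + 2 * hgamma hgauge2 hgauge2 x"
      by (subst eq, subst hlap_mult[OF C_inf_hgauge2 C_inf_hgauge2]) simp
    then have "2 * hgauge2 x * \<bar>hlap hgauge2 x\<bar> \<le> \<bar>hlap hgauge4 x\<bar> + 2 * \<bar>hgamma hgauge2 hgauge2 x\<bar>"
      using hgauge2_ge_1[of x] abs_mult[of "2 * hgauge2 x" "hlap hgauge2 x"] by simp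
    then have "2 * hgauge2 x * \<bar>hlap hgauge2 x\<bar> * hgauge x ^ 2
        \<le> (\<bar>hlap hgauge4 x\<bar> + 2 * \<bar>hgamma hgauge2 hgauge2 x\<bar>) * hgauge x ^ 2"
      by (rule mult_right_mono) simp
    also have "\<dots> = \<bar>hlap hgauge4 x\<bar> * hgauge x ^ 2 + 2 * (\<bar>hgamma hgauge2 hgauge2 x\<bar> * hgauge x ^ 2)"
      by (simp add: algebra_simps)
    also have "\<dots> \<le> C * hgauge x ^ 4 + 2 * (?N * ((C / 2 * hgauge x ^ 2) * (C / 2 * hgauge x ^ 2)))"
      by (intro add_mono mult_left_mono hgamma_bound h1 C'(4)) auto
    also have "\<dots> = 2 * hgauge2 x * ((C / 2 + ?N * (C / 2 * (C / 2))) * hgauge x ^ 2)"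
      by (simp add: hgauge_pow4 hgauge_sq hgauge2_sq[symmetric] algebra_simps)
    finally show ?thesis
      using hgauge2_ge_1[of x] by (simp only: mult.assoc) (subst (asm) mult_le_cancel_left_pos, auto)
  qed
  have "C \<ge> 0" by (rule C'(5))
  let ?K = "1 + C + ?N * (C / 2 * (C / 2))"
  have K: "1 \<le> ?K" "C / 2 \<le> ?K" "C / 2 + ?N * (C / 2 * (C / 2)) \<le> ?K"
    using \<open>C \<ge> 0\<close> by (auto intro: add_nonneg_nonneg)
  have *: "a \<le> ?K * hgauge x ^ 2" if "a \<le> b * hgauge x ^ 2" "b \<le> ?K" for a b and x :: "'n heis"
    using that mult_right_mono[OF that(2), of "hgauge x ^ 2"] by simp
  have "weighted 2 ?K (hgauge2 :: 'n heis \<Rightarrow> real)"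
    unfolding weighted_def
  proof (intro conjI allI)
    fix x :: "'n heis" and i
    show "\<bar>hgauge2 x\<bar> \<le> ?K * hgauge x ^ 2"
      by (rule *[OF _ K(1)]) (use hgauge2_ge_1[of x] in \<open>simp add: hgauge_sq\<close>)
    show "\<bar>hfield i hgauge2 x\<bar> * hgauge x \<le> ?K * hgauge x ^ 2"
      by (rule *[OF h1 K(2)])
    show "\<bar>hlap hgauge2 x\<bar> * hgauge x ^ 2 \<le> ?K * hgauge x ^ 2"
      by (rule *[OF h2 K(3)])
  qed (rule C_inf_hgauge2)
  then show ?thesis unfolding of_weight_def by blast
qed

lemma of_weight_hgauge2_power: "of_weight (2 * j) (\<lambda>x. hgauge2 x ^ j)"
proof (induction j)
  case (Suc j)
  then show ?case
    using of_weight_mult[OF of_weight_hgauge2 Suc] by simp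
qed (simp add: of_weight_const)

text \<open>
  The parameter is the inverse of the radius, measured in \<open>hgauge2\<close>.
\<close>

definition spatial_cutoff :: "real \<Rightarrow> 'n::finite heis \<Rightarrow> real" where
  "spatial_cutoff e x = cutoff (e * hgauge2 x)"

lemma C_inf_spatial_cutoff: "C_inf (spatial_cutoff e)"
  unfolding spatial_cutoff_def[abs_def]
  by (rule C_inf_real_comp[OF cutoff_C_inf]) (intro C_inf_intros C_inf_hgauge2)

lemma hfield_spatial_cutoff:
  "hfield i (spatial_cutoff e) x = cutoff' (e * hgauge2 x) * (e * hfield i hgauge2 x)"
proof -
  have g: "C_inf (\<lambda>x::'a heis. e * hgauge2 x)" by (intro C_inf_intros C_inf_hgauge2)
  show ?thesis
    unfolding spatial_cutoff_def[abs_def]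
    by (simp add: hfield_compose[OF cutoff_C_inf g] hfield_cmult C_inf_hgauge2)
qed

lemma hlap_spatial_cutoff:
  "hlap (spatial_cutoff e) x = cutoff' (e * hgauge2 x) * (e * hlap hgauge2 x) +
     cutoff'' (e * hgauge2 x) * (e ^ 2 * hgamma hgauge2 hgauge2 x)"
proof -
  have g: "C_inf (\<lambda>x::'a heis. e * hgauge2 x)" by (intro C_inf_intros C_inf_hgauge2)
  have "hgamma (\<lambda>x. e * hgauge2 x) (\<lambda>x. e * hgauge2 x) x = e ^ 2 * hgamma hgauge2 hgauge2 x"
    by (simp add: hgamma_def hfield_cmult C_inf_hgauge2 sum_distrib_left power2_eq_square mult_ac)
  then show ?thesis
    unfolding spatial_cutoff_def[abs_def]
    by (simp add: hlap_compose[OF cutoff_C_inf g] hlap_cmult C_inf_hgauge2)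
qed

lemma spatial_cutoff_near:
  assumes "e * hgauge2 x \<le> 1"
  shows "spatial_cutoff e x = 1" "hfield i (spatial_cutoff e) x = 0" "hlap (spatial_cutoff e) x = 0"
  using assms
  by (simp_all add: hfield_spatial_cutoff hlap_spatial_cutoff cutoff'_0 cutoff''_0)
    (simp add: spatial_cutoff_def cutoff_1)

text \<open>
  The cutoffs have weight 0 with one constant for all radii. The derivatives of \<open>cutoff\<close> live where
  \<open>e * hgauge2 x\<close> is at most 2, so every factor e that the chain rule produces is worth two weights
  there.
\<close>

lemma weighted_spatial_cutoff:
  obtains K where "\<And>e. e > 0 \<Longrightarrow> weighted 0 K (spatial_cutoff e :: 'n::finite heis \<Rightarrow> real)"
proof -
  obtain C where C: "weighted 2 C (hgauge2 :: 'n heis \<Rightarrow> real)"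
    using of_weight_hgauge2 unfolding of_weight_def by blast
  note C' = weightedD[OF C]
  obtain D where D: "\<And>u. \<bar>cutoff' u\<bar> \<le> D" "\<And>u. \<bar>cutoff'' u\<bar> \<le> D" "D \<ge> 1"
    using cutoff_derivs_bounded by metis
  let ?N = "real CARD('n + 'n)"
  define K1 K2 where "K1 = 2 * D * C" and "K2 = 4 * D * (?N * (C * C))"
  have nn: "C \<ge> 0" "K1 \<ge> 0" "K2 \<ge> 0" using C'(5) D(3) by (auto simp: K1_def K2_def)
  have "weighted 0 (1 + K1 + K2) (spatial_cutoff e :: 'n heis \<Rightarrow> real)" if e: "e > 0" for e
    unfolding weighted_def
  proof (intro conjI allI)
    show "C_inf (spatial_cutoff e :: 'n heis \<Rightarrow> real)" by (rule C_inf_spatial_cutoff)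
    fix x :: "'n heis" and i
    define u where "u = e * hgauge2 x"
    have u: "u > 0" using e hgauge2_ge_1[of x] by (simp add: u_def)
    show "\<bar>spatial_cutoff e x\<bar> \<le> (1 + K1 + K2) * hgauge x ^ 0"
      using nn cutoff_bounds[of "e * hgauge2 x"] by (simp add: spatial_cutoff_def)
    have d1: "\<bar>cutoff' u\<bar> * u \<le> 2 * D"
      using D cutoff'_0[of u] mult_mono[OF D(1)[of u], of u 2] u by (cases "u \<ge> 2") auto
    have d2: "\<bar>cutoff'' u\<bar> * u ^ 2 \<le> 4 * D"
    proof (cases "u \<ge> 2")
      case False
      then have "u ^ 2 \<le> 2 ^ 2" using u by (intro power_mono) auto
      with mult_mono[OF D(2)[of u] this] D(3) show ?thesis by simp
    qed (use D(3) cutoff''_0[of u] in auto)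
    have *: "\<bar>cutoff' u * (e * a)\<bar> * c \<le> K1" if "\<bar>a\<bar> * c \<le> C * hgauge x ^ 2" for a c
    proof -
      have "\<bar>cutoff' u * (e * a)\<bar> * c = \<bar>cutoff' u\<bar> * (e * (\<bar>a\<bar> * c))"
        using e by (simp add: abs_mult)
      also have "\<dots> \<le> \<bar>cutoff' u\<bar> * (e * (C * hgauge x ^ 2))"
        using that e by (intro mult_left_mono) auto
      also have "\<dots> = (\<bar>cutoff' u\<bar> * u) * C" by (simp add: u_def hgauge_sq)
      also have "\<dots> \<le> K1" unfolding K1_def using d1 nn by (intro mult_right_mono)
      finally show ?thesis .
    qed
    show "\<bar>hfield i (spatial_cutoff e) x\<bar> * hgauge x \<le> (1 + K1 + K2) * hgauge x ^ 0"
      using *[OF C'(3)[of i x]] nn by (simp add: hfield_spatial_cutoff u_def)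
    have "\<bar>cutoff'' u * (e ^ 2 * hgamma hgauge2 hgauge2 x)\<bar> * hgauge x ^ 2
        = \<bar>cutoff'' u\<bar> * (e ^ 2 * (\<bar>hgamma hgauge2 hgauge2 x\<bar> * hgauge x ^ 2))"
      by (simp add: abs_mult)
    also have "\<dots> \<le> \<bar>cutoff'' u\<bar> * (e ^ 2 * (?N * ((C * hgauge x ^ 2) * (C * hgauge x ^ 2))))"
      by (intro mult_left_mono hgamma_bound C'(3)) auto
    also have "\<dots> = (\<bar>cutoff'' u\<bar> * u ^ 2) * (?N * (C * C))"
      by (simp only: u_def hgauge_sq) (simp add: power2_eq_square)
    also have "\<dots> \<le> K2" unfolding K2_def using d2 nn by (intro mult_right_mono) auto
    finally have b: "\<bar>cutoff'' u * (e ^ 2 * hgamma hgauge2 hgauge2 x)\<bar> * hgauge x ^ 2 \<le> K2" .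
    have "\<bar>hlap (spatial_cutoff e) x\<bar> * hgauge x ^ 2 \<le>
        \<bar>cutoff' u * (e * hlap hgauge2 x)\<bar> * hgauge x ^ 2 +
        \<bar>cutoff'' u * (e ^ 2 * hgamma hgauge2 hgauge2 x)\<bar> * hgauge x ^ 2"
      unfolding hlap_spatial_cutoff u_def distrib_right[symmetric]
      by (intro mult_right_mono abs_triangle_ineq) simp
    also have "\<dots> \<le> K1 + K2" by (intro add_mono * b C'(4))
    finally show "\<bar>hlap (spatial_cutoff e) x\<bar> * hgauge x ^ 2 \<le> (1 + K1 + K2) * hgauge x ^ 0"
      by simp
  qed
  then show ?thesis by (rule that)
qed

lemma bounded_hgauge2_sublevel: "bounded {x :: 'n::finite heis. hgauge2 x \<le> B}"
proof (rule boundedI)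
  fix x :: "'n heis" assume "x \<in> {x. hgauge2 x \<le> B}"
  then have B: "hgauge2 x \<le> B" by simp
  have g: "hgauge x \<le> hgauge2 x"
    using hgauge_ge_1[of x] mult_left_mono[of 1 "hgauge x" "hgauge x"] by (simp add: hgauge_sq[symmetric] power2_eq_square)
  have "norm (fst x) \<le> (\<Sum>i\<in>UNIV. \<bar>fst x $ i\<bar>)" by (rule norm_le_l1_cart)
  also have "\<dots> \<le> (\<Sum>i::'n + 'n\<in>UNIV. B)"
    using coord_le_hgauge[of x] g B by (intro sum_mono) (meson order_trans)
  finally have 1: "norm (fst x) \<le> real CARD('n + 'n) * B" by simp
  have 2: "norm (snd x) \<le> B" using snd_le_hgauge[of x] B by (simp add: hgauge_sq)
  have "norm x \<le> norm (fst x) + norm (snd x)"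
    using norm_Pair_le[of "fst x" "snd x"] by simp
  then show "norm x \<le> real CARD('n + 'n) * B + B" using 1 2 by linarith
qed

lemma test_function_cut:
  fixes p :: "'n::finite heis \<Rightarrow> real"
  assumes p: "C_inf p" and e: "e > 0"
  shows "test_function (\<lambda>x. p x * spatial_cutoff e x)"
proof -
  have "C_inf (\<lambda>x. p x * spatial_cutoff e x)"
    by (intro C_inf_intros p C_inf_spatial_cutoff)
  moreover have "bounded {x. p x * spatial_cutoff e x \<noteq> 0}"
  proof (rule bounded_subset[OF bounded_hgauge2_sublevel])
    have "hgauge2 x \<le> 2 / e" if "spatial_cutoff e x \<noteq> 0" for x :: "'n heis"
    proof -
      have "\<not> e * hgauge2 x \<ge> 2" using that cutoff_0 by (auto simp: spatial_cutoff_def)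
      then show ?thesis using e by (simp add: field_simps)
    qed
    then show "{x. p x * spatial_cutoff e x \<noteq> 0} \<subseteq> {x. hgauge2 x \<le> 2 / e}" by auto
  qed
  ultimately show ?thesis
    by (simp add: test_function_def C_inf_def compact_closure)
qed

section \<open>Test functions\<close>

lemma ddir_outside_support:
  assumes "x \<notin> closure {z. f z \<noteq> 0}"
  shows "ddir v f x = 0"
proof -
  let ?U = "- closure {z. f z \<noteq> 0}"
  have z: "0 = f y" if "y \<in> ?U" for y
    using that closure_subset[of "{z. f z \<noteq> 0}"] by auto
  have "open ?U" by (rule open_Compl) (rule closed_closure)
  moreover have "x \<in> ?U" using assms by simp
  ultimately have "(f has_derivative (\<lambda>v. 0)) (at x)"
    using z by (rule has_derivative_transform_within_open[OF has_derivative_const])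
  then show ?thesis by (rule ddir_eq)
qed

lemma test_function_iff:
  "test_function f \<longleftrightarrow> C_inf f \<and> bounded {z. f z \<noteq> 0}" for f :: "'a::euclidean_space \<Rightarrow> real"
  by (simp add: test_function_def C_inf_def compact_closure)

lemma test_function_ddir:
  fixes f :: "'a::euclidean_space \<Rightarrow> real"
  assumes "test_function f"
  shows "test_function (ddir v f)"
proof -
  have "{z. ddir v f z \<noteq> 0} \<subseteq> closure {z. f z \<noteq> 0}"
    using ddir_outside_support by blast
  then show ?thesis
    using assms by (auto simp: test_function_iff C_inf_ddir intro: bounded_subset bounded_closure)
qed

lemma test_function_mult:
  fixes f :: "'a::euclidean_space \<Rightarrow> real"
  assumes "C_inf g" "test_function f"
  shows "test_function (\<lambda>x. g x * f x)"
  using assms by (auto simp: test_function_iff C_inf_mult elim!: bounded_subset)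

lemma test_function_add:
  fixes f :: "'a::euclidean_space \<Rightarrow> real"
  assumes "test_function f" "test_function g"
  shows "test_function (\<lambda>x. f x + g x)"
proof -
  have "bounded ({z. f z \<noteq> 0} \<union> {z. g z \<noteq> 0})"
    using assms by (simp add: test_function_iff)
  then have "bounded {z. f z + g z \<noteq> 0}"
    by (rule bounded_subset) auto
  then show ?thesis using assms by (simp add: test_function_iff C_inf_add)
qed

lemma test_function_sum:
  fixes f :: "'b \<Rightarrow> 'a::euclidean_space \<Rightarrow> real"
  assumes "\<And>a. a \<in> A \<Longrightarrow> test_function (f a)"
  shows "test_function (\<lambda>x. \<Sum>a\<in>A. f a x)"
  using assms
proof (induction A rule: infinite_finite_induct)
  case (insert a A)
  then show ?case by (simp add: test_function_add)
qed (simp_all add: test_function_iff C_inf_const)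

lemma test_function_hfield: "test_function f \<Longrightarrow> test_function (hfield i f)"
  unfolding hfield_def[abs_def] pd_def pd_last_def
  by (intro test_function_add test_function_mult test_function_ddir C_inf_twist)

lemma test_function_hlap: "test_function f \<Longrightarrow> test_function (hlap f)"
  unfolding hlap_def[abs_def] by (intro test_function_sum test_function_hfield)

lemma test_function_bounded:
  fixes f :: "'a::euclidean_space \<Rightarrow> real"
  assumes "test_function f"
  obtains M where "M \<ge> 0" "\<And>x. \<bar>f x\<bar> \<le> M"
proof -
  let ?K = "closure {z. f z \<noteq> 0}"
  have "bounded (f ` ?K)"
    using assms by (intro compact_imp_bounded compact_continuous_image C_inf_continuous)
      (auto simp: test_function_def C_inf_def)
  then obtain M where M: "\<And>x. x \<in> ?K \<Longrightarrow> \<bar>f x\<bar> \<le> M"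
    by (auto simp: bounded_iff)
  have "\<bar>f x\<bar> \<le> max M 0" for x
    using M[of x] closure_subset[of "{z. f z \<noteq> 0}"] by (cases "f x = 0") (auto simp: max.coboundedI1)
  then show ?thesis by (intro that[of "max M 0"]) auto
qed

lemma integrable_bounded_support:
  fixes g :: "real \<Rightarrow> real"
  assumes "g \<in> borel_measurable borel" "\<And>s. \<bar>g s\<bar> \<le> M" "\<And>s. s \<notin> {a..b} \<Longrightarrow> g s = 0"
  shows "integrable lborel g"
proof (rule Bochner_Integration.integrable_bound)
  show "integrable lborel (\<lambda>s. M * indicator {a..b} s :: real)"
    by (intro integrable_mult_right integrable_real_indicator) (auto simp: emeasure_lborel_Icc_eq)
  show "AE s in lborel. norm (g s) \<le> norm (M * indicator {a..b} s :: real)"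
  proof (intro AE_I2)
    fix s show "norm (g s) \<le> norm (M * indicator {a..b} s :: real)"
      using assms(2)[of s] assms(3)[of s] by (cases "s \<in> {a..b}") auto
  qed
qed (use assms(1) in simp)

section \<open>Means against the heat kernel and their evolution\<close>

text \<open>
  The heat semigroup applied to f, evaluated at the identity.
\<close>

definition hmean :: "(real \<Rightarrow> 'n::finite heis \<Rightarrow> real) \<Rightarrow> ('n heis \<Rightarrow> real) \<Rightarrow> real \<Rightarrow> real" where
  "hmean h f t = (LINT x|lborel. f x * h t x)"

locale heis_heat =
  fixes h :: "real \<Rightarrow> 'n::finite heis \<Rightarrow> real"
  assumes heat: "heat_kernel h"
begin

lemma h_zero: "t \<le> 0 \<Longrightarrow> h t x = 0"
  and h_nonneg: "h t x \<ge> 0"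
  and h_integral: "t > 0 \<Longrightarrow> (LINT x|lborel. h t x) = 1"
  and h_continuous: "continuous_on ({0<..} \<times> UNIV) (\<lambda>(t, x). h t x)"
  and h_fundamental: "fundamental_solution h"
  using heat unfolding heat_kernel_def by blast+

lemma h_measurable2 [measurable]: "(\<lambda>z. h (fst z) (snd z)) \<in> borel_measurable borel"
proof -
  have "{0<..} \<times> UNIV \<in> sets (borel :: (real \<times> 'n heis) measure)"
    by (intro borel_open open_Times) auto
  from borel_measurable_continuous_on_indicator[OF this h_continuous]
  have "(\<lambda>z. indicator ({0<..} \<times> UNIV) z *\<^sub>R (case z of (t, x) \<Rightarrow> h t x)) \<in> borel_measurable borel" .
  moreover have "(\<lambda>z. indicator ({0<..} \<times> UNIV) z *\<^sub>R (case z of (t, x) \<Rightarrow> h t x)) = (\<lambda>z. h (fst z) (snd z))"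
    by (auto simp: fun_eq_iff indicator_def h_zero)
  ultimately show ?thesis by simp
qed

lemma h_measurable [measurable]: "h t \<in> borel_measurable borel"
proof -
  have "(\<lambda>x. (t, x)) \<in> borel \<rightarrow>\<^sub>M (borel :: (real \<times> 'n heis) measure)"
    by (intro borel_measurable_continuous_onI continuous_intros)
  from measurable_compose[OF this h_measurable2] show ?thesis by simp
qed

lemma h_integrable: "integrable lborel (h t)"
proof (cases "t > 0")
  case True
  then show ?thesis
    using h_integral[OF True] not_integrable_integral_eq[of lborel "h t"] by fastforce
next
  case False
  then have "h t = (\<lambda>x. 0)" by (auto simp: fun_eq_iff h_zero)
  then show ?thesis by simp
qed

lemma hmean_nonpos: "t \<le> 0 \<Longrightarrow> hmean h f t = 0"
  by (simp add: hmean_def h_zero)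

lemma hmean_const: "t > 0 \<Longrightarrow> hmean h (\<lambda>x. c) t = c"
  by (simp add: hmean_def h_integral)

lemma integrable_times_h:
  assumes [measurable]: "f \<in> borel_measurable borel" and M: "\<And>x. \<bar>f x\<bar> \<le> M"
  shows "integrable lborel (\<lambda>x. f x * h t x)"
proof (rule Bochner_Integration.integrable_bound)
  show "integrable lborel (\<lambda>x. M * h t x)" by (intro integrable_mult_right h_integrable)
  show "AE x in lborel. norm (f x * h t x) \<le> norm (M * h t x)"
    using M h_nonneg by (intro AE_I2) (auto simp: abs_mult intro!: mult_right_mono order_trans[OF M])
qed measurable

lemma hmean_bound:
  assumes [measurable]: "f \<in> borel_measurable borel" and M: "\<And>x. \<bar>f x\<bar> \<le> M"
  shows "\<bar>hmean h f t\<bar> \<le> M"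
proof (cases "t > 0")
  case True
  have "\<bar>hmean h f t\<bar> \<le> (LINT x|lborel. \<bar>f x * h t x\<bar>)"
    unfolding hmean_def by (rule integral_abs_bound)
  also have "\<dots> \<le> (LINT x|lborel. M * h t x)"
    using M h_nonneg by (intro integral_mono integrable_abs integrable_times_h[of f M] integrable_mult_right h_integrable)
      (auto simp: abs_mult intro!: mult_right_mono)
  finally show ?thesis using h_integral[OF True] by simp
next
  case False
  then show ?thesis using M[of 0] by (simp add: hmean_nonpos)
qed

lemma h_measurable_pair: "(\<lambda>(t, x). h t x) \<in> borel_measurable (lborel \<Otimes>\<^sub>M lborel)"
proof -
  have "sets (lborel \<Otimes>\<^sub>M lborel :: (real \<times> 'n heis) measure) = sets borel"
    by (simp only: lborel_prod sets_lborel)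
  then have "borel_measurable (lborel \<Otimes>\<^sub>M lborel) = (borel_measurable borel :: ((real \<times> 'n heis) \<Rightarrow> real) set)"
    by (rule measurable_cong_sets) simp
  then show ?thesis using h_measurable2 by (simp add: split_beta')
qed

lemma hmean_measurable [measurable]:
  assumes "f \<in> borel_measurable borel"
  shows "hmean h f \<in> borel_measurable borel"
proof -
  have f: "(\<lambda>z. f (snd z)) \<in> borel_measurable (lborel \<Otimes>\<^sub>M lborel)"
    using assms by (intro measurable_compose[OF measurable_snd]) simp
  have "(\<lambda>(t, x). f x * h t x) \<in> borel_measurable (lborel \<Otimes>\<^sub>M lborel)"
    using borel_measurable_times[OF f h_measurable_pair] by (simp add: split_beta')
  from lborel.borel_measurable_lebesgue_integral[OF this] show ?thesis
    unfolding hmean_def[abs_def] by simp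
qed

text \<open>
  The defining distributional equation, tested on products of a function of time and a function of
  space. Integrability on the product space follows from the unit mass of \<open>h t\<close> for each t,
  because the test function is bounded and supported in a bounded time interval.
\<close>

lemma weak_equation:
  fixes \<eta> :: "real \<Rightarrow> real"
  assumes \<eta>: "test_function \<eta>" and \<psi>: "test_function \<psi>"
  shows "(LINT t|lborel. - ddir 1 \<eta> t * hmean h \<psi> t - \<eta> t * hmean h (hlap \<psi>) t) = \<eta> 0 * \<psi> 0"
proof -
  note \<eta>' = test_function_ddir[OF \<eta>, of 1] and A\<psi> = test_function_hlap[OF \<psi>]
  note C = \<eta>[unfolded test_function_iff, THEN conjunct1] \<psi>[unfolded test_function_iff, THEN conjunct1]
    \<eta>'[unfolded test_function_iff, THEN conjunct1] A\<psi>[unfolded test_function_iff, THEN conjunct1]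
  note [measurable] = C[THEN C_inf_measurable]
  define \<phi> :: "real \<times> 'n heis \<Rightarrow> real" where "\<phi> z = \<eta> (fst z) * \<psi> (snd z)" for z
  have "C_inf \<phi>"
    unfolding \<phi>_def[abs_def]
    by (intro C_inf_mult C_inf_linear_comp[OF bounded_linear_fst C(1)]
        C_inf_linear_comp[OF bounded_linear_snd C(2)])
  moreover have "bounded {z. \<phi> z \<noteq> 0}"
  proof (rule bounded_subset)
    show "bounded ({t. \<eta> t \<noteq> 0} \<times> {x. \<psi> x \<noteq> 0})"
      using \<eta> \<psi> by (intro bounded_Times) (auto simp: test_function_iff)
  qed (auto simp: \<phi>_def)
  ultimately have "test_function \<phi>" by (simp add: test_function_iff)
  then have main: "(LINT (t, x)|lborel. h t x * (- deriv (\<lambda>s. \<phi> (s, x)) t + sublaplacian (\<lambda>y. \<phi> (t, y)) x)) = \<phi> (0, 0)"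
    using h_fundamental unfolding fundamental_solution_def by blast
  have d: "deriv (\<lambda>s. \<phi> (s, x)) t = ddir 1 \<eta> t * \<psi> x" for t x
    unfolding \<phi>_def fst_conv snd_conv
    by (intro DERIV_imp_deriv DERIV_cmult_right C_inf_DERIV C)
  have sl: "sublaplacian (\<lambda>y. \<phi> (t, y)) x = - (\<eta> t * hlap \<psi> x)" for t x
    by (simp add: \<phi>_def sublaplacian_eq_hlap hlap_cmult C)
  have eq: "(LINT (t, x)|lborel. h t x * (- (ddir 1 \<eta> t * \<psi> x) - \<eta> t * hlap \<psi> x)) = \<eta> 0 * \<psi> 0"
    using main unfolding d sl by (simp add: \<phi>_def)
  define F where "F = (\<lambda>(t, x). h t x * (- (ddir 1 \<eta> t * \<psi> x) - \<eta> t * hlap \<psi> x))"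
  obtain M1 where M1: "M1 \<ge> 0" "\<And>t. \<bar>\<eta> t\<bar> \<le> M1" using test_function_bounded[OF \<eta>] by metis
  obtain M2 where M2: "M2 \<ge> 0" "\<And>t. \<bar>ddir 1 \<eta> t\<bar> \<le> M2" using test_function_bounded[OF \<eta>'] by metis
  obtain M3 where M3: "M3 \<ge> 0" "\<And>x. \<bar>\<psi> x\<bar> \<le> M3" using test_function_bounded[OF \<psi>] by metis
  obtain M4 where M4: "M4 \<ge> 0" "\<And>x. \<bar>hlap \<psi> x\<bar> \<le> M4" using test_function_bounded[OF A\<psi>] by metis
  have "bounded ({t. \<eta> t \<noteq> 0} \<union> {t. ddir 1 \<eta> t \<noteq> 0})"
    using \<eta> \<eta>' by (simp add: test_function_iff)
  then obtain R where "\<forall>t\<in>{t. \<eta> t \<noteq> 0} \<union> {t. ddir 1 \<eta> t \<noteq> 0}. \<bar>t\<bar> \<le> R"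
    by (auto simp: bounded_iff)
  then have R: "\<eta> t = 0 \<and> ddir 1 \<eta> t = 0" if "\<bar>t\<bar> > R" for t
    using that by force
  let ?M = "M2 * M3 + M1 * M4"
  have gb: "\<bar>- (ddir 1 \<eta> t * \<psi> x) - \<eta> t * hlap \<psi> x\<bar> \<le> ?M" for t x
  proof -
    have "\<bar>ddir 1 \<eta> t * \<psi> x\<bar> \<le> M2 * M3" "\<bar>\<eta> t * hlap \<psi> x\<bar> \<le> M1 * M4"
      unfolding abs_mult by (intro mult_mono M1 M2 M3 M4 abs_ge_zero)+
    then show ?thesis by linarith
  qed
  have meas: "F \<in> borel_measurable (lborel \<Otimes>\<^sub>M lborel)"
  proof -
    have [measurable]: "(\<lambda>z. h (fst z) (snd z)) \<in> borel_measurable (lborel \<Otimes>\<^sub>M lborel)"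
      using h_measurable_pair by (simp add: split_beta')
    show ?thesis unfolding F_def split_beta' by measurable
  qed
  have int2: "integrable lborel (\<lambda>x. F (t, x))" for t
  proof -
    have "integrable lborel (\<lambda>x. (- (ddir 1 \<eta> t * \<psi> x) - \<eta> t * hlap \<psi> x) * h t x)"
      by (rule integrable_times_h[OF _ gb]) measurable
    then show ?thesis by (simp add: F_def mult.commute)
  qed
  have "integrable (lborel \<Otimes>\<^sub>M lborel) F"
  proof (rule lborel_pair.Fubini_integrable[OF meas])
    show "AE t in lborel. integrable lborel (\<lambda>x. F (t, x))" using int2 by simp
    show "integrable lborel (\<lambda>t. LINT x|lborel. norm (F (t, x)))"
    proof (rule integrable_bounded_support)
      show "(\<lambda>t. LINT x|lborel. norm (F (t, x))) \<in> borel_measurable borel"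
        using lborel.borel_measurable_lebesgue_integral[of "\<lambda>t x. norm (F (t, x))" lborel] meas by simp
      show "(LINT x|lborel. norm (F (t, x))) = 0" if "t \<notin> {-R..R}" for t
        using R[of t] that by (force simp: F_def)
      show "\<bar>LINT x|lborel. norm (F (t, x))\<bar> \<le> ?M" for t
      proof -
        have "norm (F (t, x)) = \<bar>- (ddir 1 \<eta> t * \<psi> x) - \<eta> t * hlap \<psi> x\<bar> * h t x" for x
          using h_nonneg[of t x] by (simp add: F_def abs_mult)
        then show ?thesis
          using hmean_bound[of "\<lambda>x. \<bar>- (ddir 1 \<eta> t * \<psi> x) - \<eta> t * hlap \<psi> x\<bar>" ?M t] gb
          by (simp add: hmean_def)
      qed
    qed
  qed
  from lborel_pair.integral_fst'[OF this] eq
  have "(LINT t|lborel. LINT x|lborel. F (t, x)) = \<eta> 0 * \<psi> 0"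
    by (simp add: F_def lborel_prod)
  moreover have "(LINT x|lborel. F (t, x)) = - ddir 1 \<eta> t * hmean h \<psi> t - \<eta> t * hmean h (hlap \<psi>) t" for t
  proof -
    have i: "integrable lborel (\<lambda>x. \<psi> x * h t x)" "integrable lborel (\<lambda>x. hlap \<psi> x * h t x)"
      by (rule integrable_times_h[OF _ M3(2)], measurable) (rule integrable_times_h[OF _ M4(2)], measurable)
    have "(LINT x|lborel. F (t, x)) = (LINT x|lborel. - ddir 1 \<eta> t * (\<psi> x * h t x) - \<eta> t * (hlap \<psi> x * h t x))"
      by (intro Bochner_Integration.integral_cong) (simp_all add: F_def algebra_simps)
    also have "\<dots> = - ddir 1 \<eta> t * hmean h \<psi> t - \<eta> t * hmean h (hlap \<psi>) t"
      unfolding hmean_def by (subst Bochner_Integration.integral_diff) (use i in auto)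
    finally show ?thesis .
  qed
  ultimately show ?thesis by simp
qed

text \<open>
  Continuity of h on compact sets suffices because the test function has compact support.
  Approaching t from the right keeps the times bounded away from 0.
\<close>

lemma hmean_right_continuous:
  assumes \<psi>: "test_function \<psi>" and t: "t > 0"
    and s: "s \<longlonglongrightarrow> t" "\<And>m. s m \<in> {t..t + 1}"
  shows "(\<lambda>m. hmean h \<psi> (s m)) \<longlonglongrightarrow> hmean h \<psi> t"
proof -
  let ?K = "closure {x. \<psi> x \<noteq> 0}"
  have C: "C_inf \<psi>" and K: "compact ?K"
    using \<psi> by (auto simp: test_function_def C_inf_def)
  note [measurable] = C_inf_measurable[OF C]
  have "open ({0<..} \<times> UNIV :: (real \<times> 'n heis) set)" by (intro open_Times) auto
  then have "\<forall>z\<in>{0<..} \<times> UNIV. isCont (\<lambda>(t, x). h t x) z"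
    using h_continuous continuous_on_eq_continuous_at by blast
  then have "isCont (\<lambda>(t, x). h t x) (t, x)" for x
    by (rule bspec) (use t in simp)
  from isCont_tendsto_compose[OF this tendsto_Pair[OF s(1) tendsto_const]]
  have lim: "(\<lambda>m. h (s m) x) \<longlonglongrightarrow> h t x" for x
    by simp
  have "bounded ((\<lambda>(t, x). h t x) ` ({t..t + 1} \<times> ?K))"
    using t K by (intro compact_imp_bounded compact_continuous_image compact_Times
        continuous_on_subset[OF h_continuous]) auto
  then obtain B where "\<forall>z\<in>{t..t + 1} \<times> ?K. \<bar>(case z of (t, x) \<Rightarrow> h t x)\<bar> \<le> B"
    by (auto simp: bounded_iff)
  then have B: "\<bar>h u x\<bar> \<le> B" if "u \<in> {t..t + 1}" "x \<in> ?K" for u x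
    using that by auto
  obtain M where M: "M \<ge> 0" "\<And>x. \<bar>\<psi> x\<bar> \<le> M" using test_function_bounded[OF \<psi>] by metis
  show ?thesis
    unfolding hmean_def
  proof (rule integral_dominated_convergence)
    show "(\<lambda>x. \<psi> x * h t x) \<in> borel_measurable lborel" "\<And>m. (\<lambda>x. \<psi> x * h (s m) x) \<in> borel_measurable lborel"
      by measurable
    show "AE x in lborel. (\<lambda>m. \<psi> x * h (s m) x) \<longlonglongrightarrow> \<psi> x * h t x"
      by (intro AE_I2 tendsto_intros lim)
    show "integrable lborel (\<lambda>x. M * B * indicator ?K x)"
      using emeasure_compact_finite[OF K] borel_compact[OF K]
      by (intro integrable_mult_right integrable_real_indicator) simp_all
    show "AE x in lborel. norm (\<psi> x * h (s m) x) \<le> M * B * indicator ?K x" for m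
    proof (rule AE_I2)
      fix x show "norm (\<psi> x * h (s m) x) \<le> M * B * indicator ?K x"
      proof (cases "x \<in> ?K")
        case True
        have "\<bar>\<psi> x\<bar> * \<bar>h (s m) x\<bar> \<le> M * B"
          by (intro mult_mono M B s(2) True abs_ge_zero)
        then show ?thesis using True by (simp add: abs_mult)
      next
        case False
        then have "\<psi> x = 0" using closure_subset[of "{x. \<psi> x \<noteq> 0}"] by auto
        then show ?thesis using False by simp
      qed
    qed
  qed
qed

text \<open>
  The equation $\frac{d}{dt}\int\psi h = -\int(\mathcal{L}\psi) h$ in integrated form. It is read off
  from the weak equation with a time cutoff that decreases from 1 to 0 on an interval
  \<open>{t..t + 1/k}\<close>: as k grows, its derivative becomes minus a unit mass at t, and the cutoff itself
  tends to the indicator of the times up to t.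
\<close>

lemma hmean_evolution_test:
  assumes \<psi>: "test_function \<psi>" and t: "t > 0"
  shows "hmean h \<psi> t = \<psi> 0 + (LINT s|lborel. indicator {0<..t} s * hmean h (hlap \<psi>) s)"
proof -
  define u v where "u = hmean h \<psi>" and "v = hmean h (hlap \<psi>)"
  note A\<psi> = test_function_hlap[OF \<psi>]
  have [measurable]: "\<psi> \<in> borel_measurable borel" "hlap \<psi> \<in> borel_measurable borel"
    using \<psi> A\<psi> by (auto simp: test_function_iff intro: C_inf_measurable)
  obtain Mu where "\<And>x. \<bar>\<psi> x\<bar> \<le> Mu" using test_function_bounded[OF \<psi>] by metis
  then have Mu: "\<bar>u s\<bar> \<le> Mu" for s unfolding u_def by (intro hmean_bound) auto
  obtain Mv where "\<And>x. \<bar>hlap \<psi> x\<bar> \<le> Mv" using test_function_bounded[OF A\<psi>] by metis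
  then have Mv: "\<bar>v s\<bar> \<le> Mv" for s unfolding v_def by (intro hmean_bound) auto
  have [measurable]: "u \<in> borel_measurable borel" "v \<in> borel_measurable borel"
    unfolding u_def v_def by (intro hmean_measurable; measurable)+
  have uv0: "u s = 0" "v s = 0" if "s \<le> 0" for s
    using that by (simp_all add: u_def v_def hmean_nonpos)
  have [measurable]: "cutoff \<in> borel_measurable borel" "cutoff' \<in> borel_measurable borel"
    by (rule C_inf_measurable[OF cutoff_C_inf], rule C_inf_measurable[OF cutoff'_C_inf])
  obtain D where D: "\<And>u. \<bar>cutoff' u\<bar> \<le> D" "D \<ge> 1"
    using cutoff_derivs_bounded by metis
  define I where "I m = (LINT y|lborel. cutoff' y * u (t + (y - 1) / real (Suc m)))" for m
  define J where "J m = (LINT s|lborel. cutoff (1 + (s - t) * real (Suc m)) * v s)" for m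
  have IJ: "- I m - J m = \<psi> 0" for m
  proof -
    define k where "k = real (Suc m)"
    have k: "k \<ge> 1" by (simp add: k_def)
    \<comment> \<open>The factor \<open>cutoff (- s)\<close> only serves to make the support compact: it is 1 for positive times,
    and the heat kernel vanishes at the others.\<close>
    define \<eta> where "\<eta> s = cutoff (1 + (s - t) * k) * cutoff (- s)" for s
    have lin: "C_inf (\<lambda>s::real. a + b * s)" for a b
      by (intro C_inf_intros C_inf_linear bounded_linear_ident)
    have "C_inf (\<lambda>s. cutoff ((1 - t * k) + k * s))" "C_inf (\<lambda>s. cutoff (0 + (-1) * s))"
      by (rule C_inf_real_comp[OF cutoff_C_inf lin])+
    then have "C_inf \<eta>"
      unfolding \<eta>_def[abs_def] by (intro C_inf_mult) (simp_all add: algebra_simps)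
    moreover have sup: "s \<in> {-2..t+1}" if "\<eta> s \<noteq> 0" for s
    proof -
      have "\<not> 1 + (s - t) * k \<ge> 2" "\<not> - s \<ge> 2"
        using that cutoff_0 by (auto simp: \<eta>_def)
      moreover have "(s - t) * k \<ge> 1" if "s \<ge> t + 1"
        using mult_mono[of 1 "s - t" 1 k] k that by simp
      ultimately show ?thesis by fastforce
    qed
    then have "bounded {s. \<eta> s \<noteq> 0}"
      by (intro bounded_subset[OF bounded_closed_interval[of "-2" "t+1"]]) auto
    ultimately have "test_function \<eta>" by (simp add: test_function_iff)
    from weak_equation[OF this \<psi>]
    have "(LINT s|lborel. - ddir 1 \<eta> s * u s - \<eta> s * v s) = \<eta> 0 * \<psi> 0"
      by (simp add: u_def v_def)
    moreover have "\<eta> 0 = 1" using k t by (simp add: \<eta>_def cutoff_1)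
    moreover have "- ddir 1 \<eta> s * u s - \<eta> s * v s =
        - (k * cutoff' (1 + (s - t) * k) * u s) - cutoff (1 + (s - t) * k) * v s" for s
    proof (cases "s > 0")
      case True
      have 1: "((\<lambda>s. 1 + (s - t) * k) has_real_derivative k) (at s)"
        by (auto intro!: derivative_eq_intros)
      have 2: "((\<lambda>s. - s) has_real_derivative - 1) (at s)"
        by (auto intro!: derivative_eq_intros)
      have "(\<eta> has_real_derivative cutoff' (1 + (s - t) * k) * k * cutoff (- s)
          + cutoff' (- s) * (- 1) * cutoff (1 + (s - t) * k)) (at s)"
        unfolding \<eta>_def[abs_def]
        by (rule DERIV_mult[OF DERIV_chain2[OF cutoff_DERIV 1] DERIV_chain2[OF cutoff_DERIV 2]])
      then have "ddir 1 \<eta> s = cutoff' (1 + (s - t) * k) * k"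
        using DERIV_unique[OF C_inf_DERIV[OF \<open>C_inf \<eta>\<close>]] True by (simp add: cutoff_1 cutoff'_0)
      then show ?thesis using True by (simp add: \<eta>_def cutoff_1 mult.commute)
    qed (simp add: uv0)
    ultimately have eq: "(LINT s|lborel. - (k * cutoff' (1 + (s - t) * k) * u s)
        - cutoff (1 + (s - t) * k) * v s) = \<psi> 0"
      by simp
    have i1: "integrable lborel (\<lambda>s. k * cutoff' (1 + (s - t) * k) * u s)"
    proof (rule integrable_bounded_support)
      show "\<bar>k * cutoff' (1 + (s - t) * k) * u s\<bar> \<le> k * D * Mu" for s
        unfolding abs_mult using k D Mu by (intro mult_mono) auto
      show "k * cutoff' (1 + (s - t) * k) * u s = 0" if "s \<notin> {t..t+1}" for s
      proof -
        have "1 + (s - t) * k \<le> 1 \<or> 1 + (s - t) * k \<ge> 2"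
          using that k mult_mono[of 1 "s - t" 1 k] by (auto simp: mult_le_0_iff)
        then show ?thesis by (simp add: cutoff'_0)
      qed
    qed measurable
    have i2: "integrable lborel (\<lambda>s. cutoff (1 + (s - t) * k) * v s)"
    proof (rule integrable_bounded_support)
      show "\<bar>cutoff (1 + (s - t) * k) * v s\<bar> \<le> 1 * Mv" for s
        unfolding abs_mult using cutoff_bounds Mv by (intro mult_mono) auto
      show "cutoff (1 + (s - t) * k) * v s = 0" if "s \<notin> {0..t+1}" for s
      proof (cases "s \<le> 0")
        case False
        then have "1 + (s - t) * k \<ge> 2"
          using that k mult_mono[of 1 "s - t" 1 k] by auto
        then show ?thesis by (simp add: cutoff_0)
      qed (simp add: uv0)
    qed measurable
    \<comment> \<open>Rescaling time by k about t turns the concentrating derivative into a fixed profile.\<close>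
    have "(LINT s|lborel. k * cutoff' (1 + (s - t) * k) * u s) =
        \<bar>1 / k\<bar> *\<^sub>R (LINT y|lborel. k * cutoff' (1 + ((t - 1 / k) + 1 / k * y - t) * k) * u ((t - 1 / k) + 1 / k * y))"
      using k by (intro lborel_integral_real_affine) simp
    also have "\<dots> = (LINT y|lborel. cutoff' y * u (t + (y - 1) / k))"
    proof -
      have "1 + ((t - 1 / k) + 1 / k * y - t) * k = y" "(t - 1 / k) + 1 / k * y = t + (y - 1) / k" for y
        using k by (simp_all add: field_simps)
      moreover have "\<bar>1 / k\<bar> *\<^sub>R (LINT y|lborel. k * cutoff' y * u (t + (y - 1) / k)) =
          (LINT y|lborel. cutoff' y * u (t + (y - 1) / k))"
        unfolding mult.assoc using k by simp
      ultimately show ?thesis by (simp only:)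
    qed
    finally have "(LINT s|lborel. k * cutoff' (1 + (s - t) * k) * u s) = I m"
      by (simp add: I_def k_def)
    then show ?thesis
      using eq i1 i2 by (simp add: J_def k_def)
  qed
  have "I \<longlonglongrightarrow> (LINT y|lborel. cutoff' y * u t)"
    unfolding I_def
  proof (rule integral_dominated_convergence)
    show "integrable lborel (\<lambda>y::real. D * Mu * indicator {1..2} y :: real)"
      by (intro integrable_mult_right integrable_real_indicator) (auto simp: emeasure_lborel_Icc_eq)
    show "AE y in lborel. norm (cutoff' y * u (t + (y - 1) / real (Suc m))) \<le> D * Mu * indicator {1..2} y" for m
    proof (intro AE_I2)
      fix y show "norm (cutoff' y * u (t + (y - 1) / real (Suc m))) \<le> D * Mu * indicator {1..2} y"
      proof (cases "y \<in> {1..2}")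
        case True
        then show ?thesis using D Mu by (auto simp: abs_mult intro!: mult_mono)
      qed (use cutoff'_0[of y] in auto)
    qed
    show "AE y in lborel. (\<lambda>m. cutoff' y * u (t + (y - 1) / real (Suc m))) \<longlonglongrightarrow> cutoff' y * u t"
    proof (intro AE_I2)
      fix y show "(\<lambda>m. cutoff' y * u (t + (y - 1) / real (Suc m))) \<longlonglongrightarrow> cutoff' y * u t"
      proof (cases "y \<in> {1..2}")
        case True
        have "(\<lambda>m. t + (y - 1) * (1 / real (Suc m))) \<longlonglongrightarrow> t + (y - 1) * 0"
          by (intro tendsto_intros LIMSEQ_Suc[OF lim_1_over_n])
        then have "(\<lambda>m. t + (y - 1) / real (Suc m)) \<longlonglongrightarrow> t" by simp
        moreover have "t + (y - 1) / real (Suc m) \<in> {t..t+1}" for m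
          using True by (simp add: field_simps)
        ultimately have "(\<lambda>m. u (t + (y - 1) / real (Suc m))) \<longlonglongrightarrow> u t"
          unfolding u_def by (rule hmean_right_continuous[OF \<psi> t])
        then show ?thesis by (intro tendsto_intros)
      qed (use cutoff'_0[of y] in auto)
    qed
  qed measurable
  moreover have "(LINT y|lborel. cutoff' y) = - 1"
  proof -
    have "(LINT y|lborel. cutoff' y * indicator {1..2} y) = cutoff 2 - cutoff 1"
      using C_inf_continuous[OF cutoff'_C_inf, of UNIV]
      by (intro integral_FTC_Icc_real cutoff_DERIV) (auto simp: continuous_on_eq_continuous_at)
    moreover have "cutoff' y * indicator {1..2} y = cutoff' y" for y
      using cutoff'_0[of y] by (cases "y \<in> {1..2}") auto
    ultimately show ?thesis by (simp add: cutoff_0 cutoff_1)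
  qed
  ultimately have I: "I \<longlonglongrightarrow> - u t" by simp
  have J: "J \<longlonglongrightarrow> (LINT s|lborel. indicator {0<..t} s * v s)"
    unfolding J_def
  proof (rule integral_dominated_convergence)
    show "integrable lborel (\<lambda>y::real. Mv * indicator {0..t+1} y :: real)"
      using t by (intro integrable_mult_right integrable_real_indicator) (auto simp: emeasure_lborel_Icc_eq)
    show "AE s in lborel. norm (cutoff (1 + (s - t) * real (Suc m)) * v s) \<le> Mv * indicator {0..t+1} s" for m
    proof (intro AE_I2)
      fix s
      consider "s < 0" | "s > t + 1" | "s \<in> {0..t+1}" by fastforce
      then show "norm (cutoff (1 + (s - t) * real (Suc m)) * v s) \<le> Mv * indicator {0..t+1} s"
      proof cases
        case 2
        then have "1 + (s - t) * real (Suc m) \<ge> 2"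
          using mult_mono[of 1 "s - t" 1 "real (Suc m)"] by auto
        then show ?thesis using Mv[of 0] by (simp add: cutoff_0 indicator_def)
      next
        case 3
        have "\<bar>cutoff (1 + (s - t) * real (Suc m))\<bar> * \<bar>v s\<bar> \<le> 1 * Mv"
          using cutoff_bounds Mv by (intro mult_mono) auto
        then show ?thesis using 3 by (simp add: abs_mult)
      qed (simp add: uv0)
    qed
    show "AE s in lborel. (\<lambda>m. cutoff (1 + (s - t) * real (Suc m)) * v s) \<longlonglongrightarrow> indicator {0<..t} s * v s"
    proof (intro AE_I2)
      fix s
      consider "s \<le> 0" | "s > t" | "s \<in> {0<..t}" by fastforce
      then show "(\<lambda>m. cutoff (1 + (s - t) * real (Suc m)) * v s) \<longlonglongrightarrow> indicator {0<..t} s * v s"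
      proof cases
        case 1
        then show ?thesis by (simp add: uv0)
      next
        case 2
        obtain N where N: "1 / (s - t) < real N" using reals_Archimedean2 by blast
        have "\<forall>\<^sub>F m in sequentially. cutoff (1 + (s - t) * real (Suc m)) * v s = 0"
        proof (rule eventually_sequentiallyI[of N])
          fix m assume "m \<ge> N"
          then have "1 / (s - t) \<le> real (Suc m)" using N by simp
          then have "1 + (s - t) * real (Suc m) \<ge> 2" using 2 by (simp add: field_simps)
          then show "cutoff (1 + (s - t) * real (Suc m)) * v s = 0" by (simp add: cutoff_0)
        qed
        then show ?thesis using 2 by (simp add: tendsto_eventually)
      next
        case 3
        then have "1 + (s - t) * real (Suc m) \<le> 1" for m by (simp add: mult_le_0_iff)
        then show ?thesis using 3 by (simp add: cutoff_1)
      qed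
    qed
  qed measurable
  have "(\<lambda>m. - I m - J m) \<longlonglongrightarrow> - (- u t) - (LINT s|lborel. indicator {0<..t} s * v s)"
    by (intro tendsto_intros I J)
  then have "- (- u t) - (LINT s|lborel. indicator {0<..t} s * v s) = \<psi> 0"
    unfolding IJ using LIMSEQ_unique tendsto_const by blast
  then show ?thesis by (simp add: u_def v_def)
qed

text \<open>
  The weight of p drops by two even in the presence of the cutoff, so the bound is the one that
  \<open>hlap p\<close> itself satisfies, and it involves the constant K but not the radius.
\<close>

lemma hlap_weighted_cut_bound:
  fixes p :: "'n heis \<Rightarrow> real"
  assumes p: "weighted (2 * Suc j) C p" and K: "weighted 0 K (spatial_cutoff e :: 'n heis \<Rightarrow> real)"
  shows "\<bar>hlap (\<lambda>x. p x * spatial_cutoff e x) x\<bar>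
      \<le> (2 + 2 * real CARD('n + 'n)) * (C * K) * hgauge2 x ^ j"
proof -
  let ?D = "(2 + 2 * real CARD('n + 'n)) * (C * K)"
  have "\<bar>hlap (\<lambda>x. p x * spatial_cutoff e x) x\<bar> * hgauge x ^ 2 \<le> ?D * hgauge x ^ (2 * Suc j + 0)"
    by (rule weightedD(4)[OF weighted_mult[OF p K]])
  then have "\<bar>hlap (\<lambda>x. p x * spatial_cutoff e x) x\<bar> * hgauge2 x \<le> (?D * hgauge2 x ^ j) * hgauge2 x"
    by (simp only: add_0_right power_mult hgauge_sq power_Suc) (simp only: mult_ac)
  then show ?thesis
    using hgauge2_ge_1[of x] by (subst (asm) mult_le_cancel_right_pos) auto
qed

text \<open>
  The moments of weight 2j are finite, uniformly on bounded time intervals.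
\<close>

definition moment_bounded :: "nat \<Rightarrow> bool" where
  "moment_bounded j \<longleftrightarrow> (\<forall>T. \<exists>B. \<forall>t\<in>{0<..T}. integrable lborel (\<lambda>x. hgauge2 x ^ j * h t x) \<and>
     hmean h (\<lambda>x. hgauge2 x ^ j) t \<le> B)"

lemma hgauge2_measurable [measurable]: "hgauge2 \<in> borel_measurable borel"
  by (rule C_inf_measurable[OF C_inf_hgauge2])

lemma integrable_of_moment:
  assumes [measurable]: "f \<in> borel_measurable borel" and f: "\<And>x. \<bar>f x\<bar> \<le> C * hgauge2 x ^ j"
    and i: "integrable lborel (\<lambda>x. hgauge2 x ^ j * h t x)"
  shows "integrable lborel (\<lambda>x. f x * h t x)" "\<bar>hmean h f t\<bar> \<le> C * hmean h (\<lambda>x. hgauge2 x ^ j) t"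
proof -
  have i': "integrable lborel (\<lambda>x. C * (hgauge2 x ^ j * h t x))"
    using i by (rule integrable_mult_right)
  have le: "\<bar>f x * h t x\<bar> \<le> C * (hgauge2 x ^ j * h t x)" for x
    using mult_right_mono[OF f[of x] h_nonneg[of t x]] h_nonneg[of t x] by (simp add: abs_mult mult.assoc)
  show if': "integrable lborel (\<lambda>x. f x * h t x)"
  proof (rule Bochner_Integration.integrable_bound[OF i'])
    show "AE x in lborel. norm (f x * h t x) \<le> norm (C * (hgauge2 x ^ j * h t x))"
    proof (rule AE_I2)
      fix x show "norm (f x * h t x) \<le> norm (C * (hgauge2 x ^ j * h t x))"
        using le[of x] by simp
    qed
  qed measurable
  have "\<bar>hmean h f t\<bar> \<le> (LINT x|lborel. \<bar>f x * h t x\<bar>)"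
    unfolding hmean_def by (rule integral_abs_bound)
  also have "\<dots> \<le> (LINT x|lborel. C * (hgauge2 x ^ j * h t x))"
    by (intro integral_mono integrable_abs if' i' le)
  finally show "\<bar>hmean h f t\<bar> \<le> C * hmean h (\<lambda>x. hgauge2 x ^ j) t"
    by (simp add: hmean_def)
qed

lemma hlap_cut_bound:
  fixes p :: "'n heis \<Rightarrow> real"
  assumes p: "of_weight (2 * Suc j) p"
  obtains D where "D \<ge> 0"
    "\<And>e x. e > 0 \<Longrightarrow> \<bar>hlap (\<lambda>x. p x * spatial_cutoff e x) x\<bar> \<le> D * hgauge2 x ^ j"
proof -
  obtain C where C: "weighted (2 * Suc j) C p" using p by (auto simp: of_weight_def)
  obtain K where K: "\<And>e. e > 0 \<Longrightarrow> weighted 0 K (spatial_cutoff e :: 'n heis \<Rightarrow> real)"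
    using weighted_spatial_cutoff by metis
  have "C \<ge> 0" "K \<ge> 0" using weightedD(5)[OF C] weightedD(5)[OF K[of 1]] by auto
  then show ?thesis
    using hlap_weighted_cut_bound[OF C K] by (intro that[of "(2 + 2 * real CARD('n + 'n)) * (C * K)"]) auto
qed

lemma hmean_evolution_cut:
  assumes p: "C_inf p" and t: "t > 0" and e: "0 < e" "e \<le> 1"
  shows "hmean h (\<lambda>x. p x * spatial_cutoff e x) t = p 0 +
    (LINT s|lborel. indicator {0<..t} s * hmean h (hlap (\<lambda>x. p x * spatial_cutoff e x)) s)"
  using hmean_evolution_test[OF test_function_cut[OF p e(1)] t] spatial_cutoff_near(1)[of e "0 :: 'n heis"] e(2)
  by simp

lemma spatial_cutoff_tendsto:
  "(\<lambda>m. f (spatial_cutoff (1 / real (Suc m)) x)) \<longlonglongrightarrow> f 1"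
proof (rule tendsto_eventually)
  obtain N where N: "hgauge2 x < real N" using reals_Archimedean2 by blast
  show "\<forall>\<^sub>F m in sequentially. f (spatial_cutoff (1 / real (Suc m)) x) = f 1"
  proof (rule eventually_sequentiallyI[of N])
    fix m assume "m \<ge> N"
    then have "1 / real (Suc m) * hgauge2 x \<le> 1" using N by (simp add: field_simps)
    then show "f (spatial_cutoff (1 / real (Suc m)) x) = f 1" by (simp add: spatial_cutoff_near)
  qed
qed

lemma hlap_cut_tendsto:
  assumes p: "C_inf p"
  shows "(\<lambda>m. hlap (\<lambda>x. p x * spatial_cutoff (1 / real (Suc m)) x) x) \<longlonglongrightarrow> hlap p x"
proof (rule tendsto_eventually)
  obtain N where N: "hgauge2 x < real N" using reals_Archimedean2 by blast
  show "\<forall>\<^sub>F m in sequentially. hlap (\<lambda>x. p x * spatial_cutoff (1 / real (Suc m)) x) x = hlap p x"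
  proof (rule eventually_sequentiallyI[of N])
    fix m assume "m \<ge> N"
    then have "1 / real (Suc m) * hgauge2 x \<le> 1" using N by (simp add: field_simps)
    then show "hlap (\<lambda>x. p x * spatial_cutoff (1 / real (Suc m)) x) x = hlap p x"
      by (simp add: hlap_mult[OF p C_inf_spatial_cutoff] spatial_cutoff_near hgamma_def)
  qed
qed

lemma moment_bounded_0: "moment_bounded 0"
  unfolding moment_bounded_def
  by (intro allI exI[of _ 1] ballI) (auto simp: h_integrable hmean_const)

text \<open>
  For \<open>p = hgauge2 ^ Suc j\<close> the truncations of p evolve at a rate of size \<open>hgauge2 ^ j\<close>, whose mean is
  bounded by hypothesis. Hence the means of the truncations are bounded independently of the radius,
  and Fatou's lemma passes to p.
\<close>

lemma moment_bounded_Suc: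
  assumes mom: "moment_bounded j"
  shows "moment_bounded (Suc j)"
  unfolding moment_bounded_def
proof
  fix T :: real
  define p :: "'n heis \<Rightarrow> real" where "p x = hgauge2 x ^ Suc j" for x
  have p: "C_inf p" "p 0 = 1" "\<And>x. p x \<ge> 0"
    unfolding p_def[abs_def]
    by (simp_all only: hgauge2_0 power_one C_inf_power C_inf_hgauge2)
      (meson hgauge2_ge_1 order_trans zero_le_one zero_le_power)
  note [measurable] = C_inf_measurable[OF p(1)] C_inf_measurable[OF C_inf_spatial_cutoff]
  have "of_weight (2 * Suc j) p" unfolding p_def by (rule of_weight_hgauge2_power)
  from hlap_cut_bound[OF this]
  obtain D where D: "D \<ge> 0"
    "\<And>e x. e > 0 \<Longrightarrow> \<bar>hlap (\<lambda>x. p x * spatial_cutoff e x) x\<bar> \<le> D * hgauge2 x ^ j"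
    by metis
  obtain B where B: "\<And>t. t \<in> {0<..T} \<Longrightarrow> integrable lborel (\<lambda>x. hgauge2 x ^ j * h t x)"
    "\<And>t. t \<in> {0<..T} \<Longrightarrow> hmean h (\<lambda>x. hgauge2 x ^ j) t \<le> B"
    using mom unfolding moment_bounded_def by blast
  define e where "e m = 1 / real (Suc m)" for m
  have e: "0 < e m" "e m \<le> 1" for m by (auto simp: e_def)
  let ?q = "\<lambda>m x. p x * spatial_cutoff (e m) x"
  have q: "C_inf (?q m)" for m by (intro C_inf_intros p C_inf_spatial_cutoff)
  have main: "hmean h (?q m) t \<le> 1 + T * (D * B)" if t: "t \<in> {0<..T}" for t m
  proof -
    have bd: "\<bar>hmean h (hlap (?q m)) s\<bar> \<le> D * B" if "s \<in> {0<..t}" for s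
    proof -
      have s: "s \<in> {0<..T}" using that t by auto
      have "\<bar>hmean h (hlap (?q m)) s\<bar> \<le> D * hmean h (\<lambda>x. hgauge2 x ^ j) s"
        by (rule integrable_of_moment(2)[OF C_inf_measurable[OF C_inf_hlap[OF q]] D(2)[OF e(1)] B(1)[OF s]])
      also have "\<dots> \<le> D * B" using B(2)[OF s] D(1) by (rule mult_left_mono)
      finally show ?thesis .
    qed
    have DB: "D * B \<ge> 0" using bd[of t] t by (meson abs_ge_zero order_trans greaterThanAtMost_iff order_refl)
    have "(LINT s|lborel. indicator {0<..t} s * hmean h (hlap (?q m)) s) \<le>
        (LINT s|lborel. D * B * indicator {0<..t} s)"
    proof (rule integral_mono)
      show "integrable lborel (\<lambda>s. indicator {0<..t} s * hmean h (hlap (?q m)) s)"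
      proof (rule integrable_bounded_support)
        show "\<bar>indicator {0<..t} s * hmean h (hlap (?q m)) s\<bar> \<le> D * B" for s
          using bd[of s] DB by (auto simp: indicator_def)
        show "indicator {0<..t} s * hmean h (hlap (?q m)) s = 0" if "s \<notin> {0..t}" for s
          using that by auto
        have [measurable]: "hmean h (hlap (?q m)) \<in> borel_measurable borel"
          by (intro hmean_measurable C_inf_measurable C_inf_hlap q)
        show "(\<lambda>s. indicator {0<..t} s * hmean h (hlap (?q m)) s) \<in> borel_measurable borel"
          by measurable
      qed
      show "integrable lborel (\<lambda>s. D * B * indicator {0<..t} s)"
        using t by (intro integrable_mult_right integrable_real_indicator) auto
      show "indicator {0<..t} s * hmean h (hlap (?q m)) s \<le> D * B * indicator {0<..t} s" for s
        using bd[of s] by (auto simp: indicator_def)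
    qed
    also have "\<dots> = D * B * t" using t by simp
    also have "\<dots> \<le> T * (D * B)" using t DB by (simp add: mult_right_mono mult.commute)
    finally show ?thesis
      using hmean_evolution_cut[OF p(1) _ e, of t m] t p(2) by simp
  qed
  show "\<exists>B. \<forall>t\<in>{0<..T}. integrable lborel (\<lambda>x. hgauge2 x ^ Suc j * h t x) \<and>
     hmean h (\<lambda>x. hgauge2 x ^ Suc j) t \<le> B"
  proof (intro exI[of _ "1 + T * (D * B)"] ballI)
    fix t assume t: "t \<in> {0<..T}"
    have nn: "0 \<le> ?q m x * h t x" for m x
      using p(3)[of x] h_nonneg[of t x] cutoff_bounds by (simp add: spatial_cutoff_def)
    have qi: "integrable lborel (\<lambda>x. ?q m x * h t x)" for m
    proof -
      have "test_function (?q m)" by (rule test_function_cut[OF p(1) e(1)])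
      then obtain M where "\<And>x. \<bar>?q m x\<bar> \<le> M" using test_function_bounded by metis
      then show ?thesis by (intro integrable_times_h[OF C_inf_measurable[OF q]])
    qed
    have "0 \<le> hmean h (?q 0) t"
      unfolding hmean_def by (rule Bochner_Integration.integral_nonneg) (rule nn)
    then have bnn: "0 \<le> 1 + T * (D * B)"
      using main[OF t, of 0] by linarith
    have "(\<integral>\<^sup>+ x. ennreal (p x * h t x) \<partial>lborel) =
        (\<integral>\<^sup>+ x. liminf (\<lambda>m. ennreal (?q m x * h t x)) \<partial>lborel)"
    proof (intro nn_integral_cong)
      fix x
      have "(\<lambda>m. ennreal (p x * spatial_cutoff (e m) x * h t x)) \<longlonglongrightarrow> ennreal (p x * 1 * h t x)"
        unfolding e_def by (rule spatial_cutoff_tendsto)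
      then show "ennreal (p x * h t x) = liminf (\<lambda>m. ennreal (?q m x * h t x))"
        using lim_imp_Liminf[OF sequentially_bot] by fastforce
    qed
    also have "\<dots> \<le> liminf (\<lambda>m. \<integral>\<^sup>+ x. ennreal (?q m x * h t x) \<partial>lborel)"
      by (intro nn_integral_liminf) measurable
    also have "\<dots> \<le> liminf (\<lambda>m. ennreal (1 + T * (D * B)))"
    proof (intro Liminf_mono always_eventually allI)
      fix m
      have "(\<integral>\<^sup>+ x. ennreal (?q m x * h t x) \<partial>lborel) = ennreal (hmean h (?q m) t)"
        unfolding hmean_def by (rule nn_integral_eq_integral[OF qi]) (use nn in simp)
      then show "(\<integral>\<^sup>+ x. ennreal (?q m x * h t x) \<partial>lborel) \<le> ennreal (1 + T * (D * B))"
        using main[OF t, of m] by (simp add: ennreal_leI)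
    qed
    also have "\<dots> = ennreal (1 + T * (D * B))" by (simp add: Liminf_const)
    finally have fin: "(\<integral>\<^sup>+ x. ennreal (p x * h t x) \<partial>lborel) \<le> ennreal (1 + T * (D * B))" .
    have pnn: "0 \<le> p x * h t x" for x using p(3) h_nonneg by simp
    have pi: "integrable lborel (\<lambda>x. p x * h t x)"
    proof (rule integrableI_bounded)
      show "(\<integral>\<^sup>+ x. ennreal (norm (p x * h t x)) \<partial>lborel) < \<infinity>"
        using le_less_trans[OF fin ennreal_less_top] pnn by simp
    qed measurable
    moreover have "hmean h p t \<le> 1 + T * (D * B)"
      using fin nn_integral_eq_integral[OF pi] pnn bnn by (simp add: hmean_def)
    ultimately show "integrable lborel (\<lambda>x. hgauge2 x ^ Suc j * h t x) \<and>
        hmean h (\<lambda>x. hgauge2 x ^ Suc j) t \<le> 1 + T * (D * B)"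
      by (simp add: p_def[abs_def])
  qed
qed

lemma moment_bounded: "moment_bounded j"
  by (induction j) (simp_all add: moment_bounded_0 moment_bounded_Suc)

text \<open>
  With all moments finite, the truncations may be removed by dominated convergence, for the means at
  each time and then for the time integral.
\<close>

lemma hmean_evolution:
  fixes p :: "'n heis \<Rightarrow> real"
  assumes pw: "of_weight (2 * Suc j) p" and t: "t > 0"
  shows "hmean h p t = p 0 + (LINT s|lborel. indicator {0<..t} s * hmean h (hlap p) s)"
proof -
  obtain C where C: "weighted (2 * Suc j) C p" using pw by (auto simp: of_weight_def)
  note p = weightedD(1)[OF C]
  have pb: "\<bar>p x\<bar> \<le> C * hgauge2 x ^ Suc j" for x
    using weightedD(2)[OF C, of x] by (simp only: power_mult hgauge_sq)
  note [measurable] = C_inf_measurable[OF p] C_inf_measurable[OF C_inf_spatial_cutoff] C_inf_measurable[OF C_inf_hlap[OF p]]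
  from hlap_cut_bound[OF pw]
  obtain D where D: "D \<ge> 0"
    "\<And>e x. e > 0 \<Longrightarrow> \<bar>hlap (\<lambda>x. p x * spatial_cutoff e x) x\<bar> \<le> D * hgauge2 x ^ j"
    by metis
  obtain B where B: "\<And>s. s \<in> {0<..t} \<Longrightarrow> integrable lborel (\<lambda>x. hgauge2 x ^ j * h s x)"
    "\<And>s. s \<in> {0<..t} \<Longrightarrow> hmean h (\<lambda>x. hgauge2 x ^ j) s \<le> B"
    using moment_bounded[of j] unfolding moment_bounded_def by blast
  have Bt: "integrable lborel (\<lambda>x. hgauge2 x ^ Suc j * h t x)"
    using moment_bounded[of "Suc j"] t unfolding moment_bounded_def
    by (meson greaterThanAtMost_iff order_refl)
  define e where "e m = 1 / real (Suc m)" for m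
  have e: "0 < e m" "e m \<le> 1" for m by (auto simp: e_def)
  let ?q = "\<lambda>m x. p x * spatial_cutoff (e m) x"
  have q: "C_inf (?q m)" for m by (intro C_inf_intros p C_inf_spatial_cutoff)
  note [measurable] = C_inf_measurable[OF C_inf_hlap[OF q]]
  have "(\<lambda>m. hmean h (?q m) t) \<longlonglongrightarrow> hmean h p t"
    unfolding hmean_def
  proof (rule integral_dominated_convergence)
    show "integrable lborel (\<lambda>x. C * (hgauge2 x ^ Suc j * h t x))"
      using Bt by (rule integrable_mult_right)
    show "AE x in lborel. (\<lambda>m. p x * spatial_cutoff (e m) x * h t x) \<longlonglongrightarrow> p x * h t x"
    proof (rule AE_I2)
      fix x
      have "(\<lambda>m. p x * spatial_cutoff (e m) x * h t x) \<longlonglongrightarrow> p x * 1 * h t x"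
        unfolding e_def by (rule spatial_cutoff_tendsto)
      then show "(\<lambda>m. p x * spatial_cutoff (e m) x * h t x) \<longlonglongrightarrow> p x * h t x" by simp
    qed
    show "AE x in lborel. norm (p x * spatial_cutoff (e m) x * h t x) \<le> C * (hgauge2 x ^ Suc j * h t x)" for m
    proof (rule AE_I2)
      fix x
      have "\<bar>p x * spatial_cutoff (e m) x\<bar> \<le> \<bar>p x\<bar> * 1"
        unfolding abs_mult using cutoff_bounds
        by (intro mult_left_mono) (auto simp: spatial_cutoff_def)
      also have "\<dots> \<le> C * hgauge2 x ^ Suc j" using pb[of x] by simp
      finally have "\<bar>p x * spatial_cutoff (e m) x\<bar> * h t x \<le> (C * hgauge2 x ^ Suc j) * h t x"
        using h_nonneg by (rule mult_right_mono)
      then show "norm (p x * spatial_cutoff (e m) x * h t x) \<le> C * (hgauge2 x ^ Suc j * h t x)"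
        using h_nonneg[of t x] by (simp add: abs_mult mult.assoc)
    qed
  qed measurable
  moreover have inner: "(\<lambda>m. hmean h (hlap (?q m)) s) \<longlonglongrightarrow> hmean h (hlap p) s" if s: "s \<in> {0<..t}" for s
    unfolding hmean_def
  proof (rule integral_dominated_convergence)
    show "integrable lborel (\<lambda>x. D * (hgauge2 x ^ j * h s x))"
      using B(1)[OF s] by (rule integrable_mult_right)
    show "AE x in lborel. (\<lambda>m. hlap (?q m) x * h s x) \<longlonglongrightarrow> hlap p x * h s x"
      unfolding e_def by (intro AE_I2 tendsto_intros hlap_cut_tendsto p)
    show "AE x in lborel. norm (hlap (?q m) x * h s x) \<le> D * (hgauge2 x ^ j * h s x)" for m
    proof (rule AE_I2)
      fix x
      show "norm (hlap (?q m) x * h s x) \<le> D * (hgauge2 x ^ j * h s x)"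
        using mult_right_mono[OF D(2)[OF e(1)[of m], of x] h_nonneg[of s x]] h_nonneg[of s x]
        by (simp add: abs_mult mult.assoc)
    qed
  qed measurable
  moreover have "(\<lambda>m. LINT s|lborel. indicator {0<..t} s * hmean h (hlap (?q m)) s) \<longlonglongrightarrow>
      (LINT s|lborel. indicator {0<..t} s * hmean h (hlap p) s)"
  proof (rule integral_dominated_convergence)
    show "integrable lborel (\<lambda>s. D * B * indicator {0<..t} s)"
      using t by (intro integrable_mult_right integrable_real_indicator) auto
    show "AE s in lborel. norm (indicator {0<..t} s * hmean h (hlap (?q m)) s) \<le> D * B * indicator {0<..t} s" for m
    proof (rule AE_I2)
      fix s
      show "norm (indicator {0<..t} s * hmean h (hlap (?q m)) s) \<le> D * B * indicator {0<..t} s"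
      proof (cases "s \<in> {0<..t}")
        case True
        have "\<bar>hmean h (hlap (?q m)) s\<bar> \<le> D * hmean h (\<lambda>x. hgauge2 x ^ j) s"
          by (rule integrable_of_moment(2)[OF C_inf_measurable[OF C_inf_hlap[OF q]] D(2)[OF e(1)] B(1)[OF True]])
        also have "\<dots> \<le> D * B" using B(2)[OF True] D(1) by (rule mult_left_mono)
        finally show ?thesis using True by simp
      qed simp
    qed
    show "AE s in lborel. (\<lambda>m. indicator {0<..t} s * hmean h (hlap (?q m)) s) \<longlonglongrightarrow>
        indicator {0<..t} s * hmean h (hlap p) s"
    proof (rule AE_I2)
      fix s
      show "(\<lambda>m. indicator {0<..t} s * hmean h (hlap (?q m)) s) \<longlonglongrightarrow> indicator {0<..t} s * hmean h (hlap p) s"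
        using inner[of s] by (cases "s \<in> {0<..t}") auto
    qed
    have [measurable]: "hmean h (hlap (?q m)) \<in> borel_measurable borel" "hmean h (hlap p) \<in> borel_measurable borel" for m
      by (intro hmean_measurable; measurable)+
    show "(\<lambda>s. indicator {0<..t} s * hmean h (hlap p) s) \<in> borel_measurable lborel"
      "\<And>m. (\<lambda>s. indicator {0<..t} s * hmean h (hlap (?q m)) s) \<in> borel_measurable lborel"
      by measurable
  qed
  ultimately have "(\<lambda>m. p 0 + (LINT s|lborel. indicator {0<..t} s * hmean h (hlap (?q m)) s)) \<longlonglongrightarrow>
      p 0 + (LINT s|lborel. indicator {0<..t} s * hmean h (hlap p) s)"
    "(\<lambda>m. p 0 + (LINT s|lborel. indicator {0<..t} s * hmean h (hlap (?q m)) s)) \<longlonglongrightarrow> hmean h p t"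
    unfolding hmean_evolution_cut[OF p t e] by (auto intro: tendsto_intros)
  then show ?thesis using LIMSEQ_unique by blast
qed

lemma integrable_of_weight:
  fixes p :: "'n heis \<Rightarrow> real"
  assumes "of_weight (2 * j) p"
  shows "integrable lborel (\<lambda>x. p x * h t x)"
proof (cases "t > 0")
  case True
  obtain C where C: "weighted (2 * j) C p" using assms by (auto simp: of_weight_def)
  have pb: "\<bar>p x\<bar> \<le> C * hgauge2 x ^ j" for x
    using weightedD(2)[OF C, of x] by (simp only: power_mult hgauge_sq)
  have "integrable lborel (\<lambda>x. hgauge2 x ^ j * h t x)"
    using moment_bounded[of j] True unfolding moment_bounded_def
    by (meson greaterThanAtMost_iff order_refl)
  then show ?thesis
    by (rule integrable_of_moment(1)[OF C_inf_measurable[OF weightedD(1)[OF C]] pb])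
next
  case False
  then show ?thesis by (simp add: h_zero)
qed

end

section \<open>The generator on low-degree polynomials\<close>

text \<open>
  \<open>partner i\<close> is the coordinate symplectically conjugate to i, and \<open>orient\<close> the sign with which it
  enters the slope of the i-th field.
\<close>

definition partner :: "'n + 'n \<Rightarrow> 'n + 'n" where
  "partner i = (case i of Inl j \<Rightarrow> Inr j | Inr j \<Rightarrow> Inl j)"

definition orient :: "'n + 'n \<Rightarrow> real" where
  "orient i = (case i of Inl j \<Rightarrow> -1 | Inr j \<Rightarrow> 1)"

definition quad :: "'n + 'n \<Rightarrow> 'n + 'n \<Rightarrow> 'n::finite heis \<Rightarrow> real" where
  "quad i j x = fst x $ i * fst x $ j"

lemma twist_partner: "twist i x = orient i / 2 * fst x $ partner i"
  by (cases i) (simp_all add: twist_def orient_def partner_def)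

lemma partner_partner [simp]: "partner (partner i) = i"
  and partner_neq: "partner i \<noteq> i"
  and orient_partner: "orient (partner i) = - orient i"
  and orient_sq: "orient i * orient i = 1"
  by (cases i; simp add: partner_def orient_def)+

lemma bij_partner: "bij partner"
  by (rule bijI[OF inj_on_inverseI surjI]) (rule partner_partner)+

lemma C_inf_quad: "C_inf (quad i j)"
  unfolding quad_def[abs_def] by (intro C_inf_intros)

lemma hfield_quad:
  "hfield k (quad i j) x = (if k = i then fst x $ j else 0) + (if k = j then fst x $ i else 0)"
  unfolding quad_def[abs_def]
  by (simp add: hfield_mult[OF C_inf_coord C_inf_coord] hfield_coord)

lemma hgamma_quad:
  "hgamma f (quad i j) x = hfield i f x * fst x $ j + hfield j f x * fst x $ i"
  by (simp add: hgamma_def hfield_quad distrib_left sum.distrib if_distrib[where f="\<lambda>z. _ * z"] cong: if_cong)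

lemma hlap_quad: "hlap (quad i j) = (\<lambda>x. if i = j then 2 else 0)"
  unfolding quad_def[abs_def]
  by (rule ext) (simp add: hlap_mult[OF C_inf_coord C_inf_coord] hlap_coord hgamma_def hfield_coord
    if_distrib[where f="\<lambda>z. _ * z"] cong: if_cong)

lemma of_weight_quad: "of_weight 2 (quad i j)"
  using of_weight_mult[OF of_weight_coord of_weight_coord, of i j]
  unfolding quad_def[abs_def] by (simp add: numeral_2_eq_2)

text \<open>
  The product rule for a factor $x_i^2$, by which $x_i^4$, $x_i^6$, $x_i^2x_k^2$ and $z^2x_i^2$ arise
  from polynomials of lower weight.
\<close>

lemma hlap_quad_mult:
  assumes f: "C_inf f"
  shows "hlap (\<lambda>x. f x * quad i i x) x = 2 * f x + hlap f x * quad i i x + 4 * (hfield i f x * fst x $ i)"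
  by (simp add: hlap_mult[OF f C_inf_quad] hlap_quad hgamma_quad)

lemma hlap_quad_quad:
  "hlap (\<lambda>x. quad i i x * quad j j x) x =
     2 * quad i i x + 2 * quad j j x + (if i = j then 8 * quad i i x else 0)"
  by (simp add: hlap_quad_mult[OF C_inf_quad] hlap_quad hfield_quad) (simp add: quad_def)

lemma hlap_coord_pow6:
  "hlap (\<lambda>x. (quad i i x * quad i i x) * quad i i x) x = 30 * (quad i i x * quad i i x)"
  by (simp add: hlap_quad_mult[OF C_inf_mult[OF C_inf_quad C_inf_quad]] hlap_quad_quad
      hfield_mult[OF C_inf_quad C_inf_quad] hfield_quad)
    (simp add: quad_def algebra_simps)

lemma hlap_snd_sq: "hlap (\<lambda>x. snd x * snd x) x = 1/2 * (\<Sum>k\<in>UNIV. quad k k x)"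
  for x :: "'n::finite heis"
proof -
  have "hlap (\<lambda>x. snd x * snd x) x = 2 * (\<Sum>k\<in>UNIV. twist k x * twist k x)"
    by (simp add: hlap_mult[OF C_inf_snd C_inf_snd] hlap_snd hgamma_def hfield_snd)
  also have "twist k x * twist k x = 1/4 * quad (partner k) (partner k) x" for k
    using orient_sq[of k] by (simp add: twist_partner quad_def)
  then have "(\<Sum>k\<in>UNIV. twist k x * twist k x) = (\<Sum>k\<in>UNIV. 1/4 * quad (partner k) (partner k) x)"
    by (simp only:)
  also have "\<dots> = (\<Sum>k\<in>UNIV. 1/4 * quad k k x)"
    by (rule sum.reindex_bij_betw[OF bij_partner])
  finally show ?thesis by (simp only: sum_distrib_left[symmetric])
qed

lemma hlap_snd_quad_partner:
  "hlap (\<lambda>x. snd x * quad i (partner i) x) x =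
     orient i * (quad (partner i) (partner i) x - quad i i x)"
  using partner_neq[of i] partner_neq[of i, symmetric]
  by (simp add: hlap_mult[OF C_inf_snd C_inf_quad] hlap_snd hlap_quad hgamma_quad hfield_snd)
    (simp add: twist_partner orient_partner quad_def algebra_simps)

lemma hlap_snd_sq_quad:
  "hlap (\<lambda>x. (snd x * snd x) * quad i i x) x =
     2 * (snd x * snd x) + 1/2 * (\<Sum>k\<in>UNIV. quad k k x * quad i i x)
       + 4 * orient i * (snd x * quad i (partner i) x)"
proof -
  have "hlap (\<lambda>x. (snd x * snd x) * quad i i x) x = 2 * (snd x * snd x) +
      1/2 * (\<Sum>k\<in>UNIV. quad k k x) * quad i i x + 4 * ((snd x * twist i x + twist i x * snd x) * fst x $ i)"
    by (simp only: hlap_quad_mult[OF C_inf_mult[OF C_inf_snd C_inf_snd]] hlap_snd_sq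
      hfield_mult[OF C_inf_snd C_inf_snd] hfield_snd)
  also have "4 * ((snd x * twist i x + twist i x * snd x) * fst x $ i) =
      4 * orient i * (snd x * quad i (partner i) x)"
    by (simp add: twist_partner quad_def)
  finally show ?thesis by (simp add: sum_distrib_right)
qed

section \<open>The moments\<close>

context heis_heat
begin

lemma hmean_cmult: "hmean h (\<lambda>x. c * f x) t = c * hmean h f t"
  by (simp add: hmean_def mult.assoc)

lemma integrable_weight:
  assumes "of_weight k f"
  shows "integrable lborel (\<lambda>x. f x * h t x)"
  by (rule integrable_of_weight[OF of_weight_mono[OF assms, of "2 * k"]]) simp

lemma hmean_add:
  assumes "of_weight k f" "of_weight l g"
  shows "hmean h (\<lambda>x. f x + g x) t = hmean h f t + hmean h g t"
  unfolding hmean_def distrib_right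
  using assms[THEN integrable_weight] by (intro Bochner_Integration.integral_add)

lemma hmean_sum:
  assumes "\<And>a. a \<in> A \<Longrightarrow> of_weight k (f a)"
  shows "hmean h (\<lambda>x. \<Sum>a\<in>A. f a x) t = (\<Sum>a\<in>A. hmean h (f a) t)"
  unfolding hmean_def sum_distrib_right
  using assms[THEN integrable_weight] by (intro Bochner_Integration.integral_sum)

text \<open>
  By homogeneity all the moments are monomials in time, so integrating their evolution equation
  amounts to raising an exponent.
\<close>

lemma hmean_power_law:
  assumes p: "of_weight k p" "p 0 = 0" and t: "t > 0"
    and rate: "\<And>s. s > 0 \<Longrightarrow> hmean h (hlap p) s = c * s ^ m"
  shows "hmean h p t = c * t ^ Suc m / real (Suc m)"
proof -
  have "of_weight (2 * Suc k) p" using p(1) by (rule of_weight_mono) simp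
  from hmean_evolution[OF this t] p(2)
  have "hmean h p t = (LINT s|lborel. indicator {0<..t} s * hmean h (hlap p) s)"
    by simp
  also have "\<dots> = (LINT s|lborel. c * (s ^ m * indicator {0..t} s))"
  proof (rule integral_cong_AE)
    show "AE s in lborel. indicator {0<..t} s * hmean h (hlap p) s = c * (s ^ m * indicator {0..t} s)"
      \<comment> \<open>At time 0 the kernel is 0 by convention, so the rate is only known for positive times.\<close>
      using AE_lborel_singleton[of "0::real"] by eventually_elim (auto simp: indicator_def rate)
    have "hmean h (hlap p) \<in> borel_measurable borel"
      using p(1) weightedD(1) unfolding of_weight_def
      by (intro hmean_measurable C_inf_measurable C_inf_hlap) blast
    then show "(\<lambda>s. indicator {0<..t} s * hmean h (hlap p) s) \<in> borel_measurable lborel"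
      by measurable
  qed measurable
  also have "\<dots> = c * ((t ^ Suc m - 0 ^ Suc m) / real (Suc m))"
    using integral_power[of 0 t m] t by simp
  finally show ?thesis by simp
qed

lemma mean_quad: "t > 0 \<Longrightarrow> hmean h (quad i j) t = (if i = j then 2 else 0) * t"
  using hmean_power_law[OF of_weight_quad, of i j t "if i = j then 2 else 0" 0]
  by (simp add: hlap_quad hmean_const quad_def)

lemma mean_quad_quad:
  assumes "t > 0"
  shows "hmean h (\<lambda>x. quad i i x * quad j j x) t = (if i = j then 12 else 4) * t ^ 2"
proof -
  have "hmean h (\<lambda>x. quad i i x * quad j j x) t = (if i = j then 24 else 8) * t ^ Suc 1 / real (Suc 1)"
  proof (rule hmean_power_law[OF of_weight_mult[OF of_weight_quad of_weight_quad] _ assms])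
    fix s :: real assume s: "s > 0"
    show "hmean h (hlap (\<lambda>x. quad i i x * quad j j x)) s = (if i = j then 24 else 8) * s ^ 1"
    proof (cases "i = j")
      case True
      then have "hlap (\<lambda>x. quad i i x * quad j j x) = (\<lambda>x. 12 * quad i i x)"
        by (intro ext) (simp add: hlap_quad_quad)
      then show ?thesis using True s by (simp add: hmean_cmult mean_quad)
    next
      case False
      then have "hlap (\<lambda>x. quad i i x * quad j j x) = (\<lambda>x. 2 * (quad i i x + quad j j x))"
        by (intro ext) (simp add: hlap_quad_quad)
      then show ?thesis
        by (simp only: hmean_cmult hmean_add[OF of_weight_quad of_weight_quad] mean_quad[OF s])
          (simp add: False)
    qed
  qed (simp add: quad_def)
  then show ?thesis by (cases "i = j") (simp_all add: numeral_2_eq_2)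
qed

lemma mean_coord_pow6:
  assumes "t > 0"
  shows "hmean h (\<lambda>x. (quad i i x * quad i i x) * quad i i x) t = 120 * t ^ 3"
proof -
  have "hmean h (\<lambda>x. (quad i i x * quad i i x) * quad i i x) t = 360 * t ^ Suc 2 / real (Suc 2)"
  proof (rule hmean_power_law[OF of_weight_mult[OF of_weight_mult[OF of_weight_quad of_weight_quad] of_weight_quad] _ assms])
    fix s :: real assume s: "s > 0"
    show "hmean h (hlap (\<lambda>x. (quad i i x * quad i i x) * quad i i x)) s = 360 * s ^ 2"
      using s by (simp only: hlap_coord_pow6[abs_def] hmean_cmult mean_quad_quad) simp
  qed (simp add: quad_def)
  then show ?thesis by (simp add: eval_nat_numeral)
qed

lemma of_weight_snd_sq: "of_weight 4 (\<lambda>x. snd x * snd x)"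
  using of_weight_mult[OF of_weight_snd of_weight_snd] by simp

lemma of_weight_snd_quad: "of_weight 4 (\<lambda>x. snd x * quad i j x)"
  using of_weight_mult[OF of_weight_snd of_weight_quad] by simp

lemma mean_snd_sq:
  assumes "t > 0"
  shows "hmean h (\<lambda>x. snd x * snd x) t = real CARD('n) * t ^ 2"
proof -
  have "hmean h (\<lambda>x. snd x * snd x) t = (2 * real CARD('n)) * t ^ Suc 1 / real (Suc 1)"
  proof (rule hmean_power_law[OF of_weight_snd_sq _ assms])
    fix s :: real assume s: "s > 0"
    have "hmean h (hlap (\<lambda>x. snd x * snd x)) s = 1/2 * (\<Sum>k::'n + 'n\<in>UNIV. hmean h (quad k k) s)"
      by (simp only: hlap_snd_sq[abs_def] hmean_cmult hmean_sum[OF of_weight_quad])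
    then show "hmean h (hlap (\<lambda>x. snd x * snd x)) s = (2 * real CARD('n)) * s ^ 1"
      using s by (simp add: mean_quad)
  qed simp
  then show ?thesis by (simp add: numeral_2_eq_2)
qed

text \<open>
  The rate is the difference of the second moments of two conjugate coordinates, which agree.
\<close>

lemma mean_snd_quad_partner:
  assumes "t > 0"
  shows "hmean h (\<lambda>x. snd x * quad i (partner i) x) t = 0"
proof -
  have "hmean h (\<lambda>x. snd x * quad i (partner i) x) t = 0 * t ^ Suc 0 / real (Suc 0)"
  proof (rule hmean_power_law[OF of_weight_snd_quad _ assms])
    fix s :: real assume s: "s > 0"
    have "hmean h (\<lambda>x. quad (partner i) (partner i) x - quad i i x) s = 0"
      using s mean_quad[OF s, of i i] mean_quad[OF s, of "partner i" "partner i"]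
      unfolding hmean_def left_diff_distrib
      by (subst Bochner_Integration.integral_diff) (simp_all add: integrable_weight[OF of_weight_quad])
    then show "hmean h (hlap (\<lambda>x. snd x * quad i (partner i) x)) s = 0 * s ^ 0"
      by (simp add: hlap_snd_quad_partner[abs_def] hmean_cmult)
  qed simp
  then show ?thesis by simp
qed

lemma mean_snd_sq_quad:
  assumes "t > 0"
  shows "hmean h (\<lambda>x. (snd x * snd x) * quad i i x) t = (6 * real CARD('n) + 4) / 3 * t ^ 3"
proof -
  have "hmean h (\<lambda>x. (snd x * snd x) * quad i i x) t = (6 * real CARD('n) + 4) * t ^ Suc 2 / real (Suc 2)"
  proof (rule hmean_power_law[OF of_weight_mult[OF of_weight_snd_sq of_weight_quad] _ assms])
    fix s :: real assume s: "s > 0"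
    have w: "of_weight 4 (\<lambda>x. quad k k x * quad i i x)" for k
      using of_weight_mult[OF of_weight_quad of_weight_quad, of k k i i] by simp
    have c: "of_weight k (\<lambda>x. c * f x)" if "of_weight k f" for k c and f :: "'n heis \<Rightarrow> real"
      using of_weight_mult[OF of_weight_const[of 0 c] that] by simp
    have w1: "of_weight 4 (\<lambda>x::'n heis. 2 * (snd x * snd x))"
      by (rule c[OF of_weight_snd_sq])
    have w2: "of_weight 4 (\<lambda>x. 1/2 * (\<Sum>k\<in>UNIV. quad k k x * quad i i x))"
      by (rule c[OF of_weight_sum[OF w]])
    have w3: "of_weight 4 (\<lambda>x. 4 * orient i * (snd x * quad i (partner i) x))"
      by (rule c[OF of_weight_snd_quad])
    have "hmean h (hlap (\<lambda>x. (snd x * snd x) * quad i i x)) s =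
        2 * (real CARD('n) * s ^ 2) + 1/2 * (\<Sum>k\<in>UNIV. (if k = i then 12 else 4) * s ^ 2) + 4 * orient i * 0"
      by (simp only: hlap_snd_sq_quad[abs_def] hmean_add[OF of_weight_add[OF w1 w2] w3] hmean_add[OF w1 w2]
        hmean_cmult hmean_sum[OF w] mean_snd_sq[OF s] mean_quad_quad[OF s] mean_snd_quad_partner[OF s])
    also have "(\<Sum>k\<in>UNIV. (if k = i then 12 else 4) * s ^ 2) = (\<Sum>k\<in>UNIV. 4 * s ^ 2 + (if k = i then 8 * s ^ 2 else 0))"
      by (intro sum.cong) auto
    also have "\<dots> = (8 * real CARD('n) + 8) * s ^ 2"
      by (simp add: sum.distrib algebra_simps)
    finally show "hmean h (hlap (\<lambda>x. (snd x * snd x) * quad i i x)) s = (6 * real CARD('n) + 4) * s ^ 2"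
      by (simp add: algebra_simps)
  qed (simp add: quad_def)
  then show ?thesis by (simp add: eval_nat_numeral)
qed

end

theorem proposition8p3:
  fixes h :: "real \<Rightarrow> 'n::finite heis \<Rightarrow> real" and i :: "'n + 'n"
  assumes "heat_kernel h"
  shows "(LINT x|lborel. (fst x $ i) ^ 6 * h 1 x) = fact 5
       \<and> (LINT x|lborel. (fst x $ i)\<^sup>2 * (snd x)\<^sup>2 * h 1 x) = 2/3 * (5 + 3 * (real CARD('n) - 1))"
proof
  interpret heis_heat h using assms by unfold_locales
  have "(fst x $ i) ^ 6 = (quad i i x * quad i i x) * quad i i x" for x :: "'n heis"
    by (simp add: quad_def eval_nat_numeral)
  then show "(LINT x|lborel. (fst x $ i) ^ 6 * h 1 x) = fact 5"
    using mean_coord_pow6[of 1 i] by (simp add: hmean_def fact_numeral)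
  have "(fst x $ i)\<^sup>2 * (snd x)\<^sup>2 = (snd x * snd x) * quad i i x" for x :: "'n heis"
    by (simp add: quad_def power2_eq_square)
  then show "(LINT x|lborel. (fst x $ i)\<^sup>2 * (snd x)\<^sup>2 * h 1 x) = 2/3 * (5 + 3 * (real CARD('n) - 1))"
    using mean_snd_sq_quad[of 1 i] by (simp add: hmean_def field_simps)
qed

end
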